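(* Let $(A,\rhd_A,\lhd_A)$ and $(A^*,\rhd_{A^*},\lhd_{A^*})$ be dialgebras. Let the linear maps $\delta_{\rhd},\delta_{\lhd}:A\to A\otimes A$ be the linear duals of $\rhd_{A^*}$ and $\lhd_{A^*}$ respectively. Then the following conditions are equivalent: (a) There is a double construction of Frobenius dialgebra associated to $(A,\rhd_A,\lhd_A)$ and $(A^*,\rhd_{A^*},\lhd_{A^*})$. (b) $(A,A^*,\,-R_{\lhd}^{*},\ L_{\lhd}^{*}-L_{\rhd}^{*},\ R_{\rhd}^{*}-R_{\lhd}^{*},\ -L_{\rhd}^{*},\ -\mathcal{R}_{\lhd}^{*},\ \mathcal{L}_{\lhd}^{*}-\mathcal{L}_{\rhd}^{*},\ \mathcal{R}_{\rhd}^{*}-\mathcal{R}_{\lhd}^{*},\ -\mathcal{L}_{\rhd}^{*})$ is a matched pair of dialgebras. (c) $(A,\rhd_A,\lhd_A,\delta_{\rhd},\delta_{\lhd})$ is a bi-dialgebra.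
   Context: All vector spaces and algebras are finite-dimensional over a field $\mathbb F$ of characteristic $0$; algebras are not assumed unital. **Dialgebra.** A triple $(A,\rhd,\lhd)$ where $\rhd,\lhd$ are associative bilinear products on a vector space $A$ with $(x\lhd y)\lhd z=x\lhd(y\rhd z)$, $(x\rhd y)\lhd z=x\rhd(y\lhd z)$, $(x\lhd y)\rhd z=x\rhd(y\rhd z)$. A bilinear form $\mathfrak{B}$ on it is invariant if $\mathfrak{B}(x\rhd y,z)=\mathfrak{B}(x,y\rhd z-y\lhd z)$ and $\mathfrak{B}(x\lhd y,z)=\mathfrak{B}(x,y\rhd z)$. A skew-symmetric Frobenius dialgebra is a dialgebra with a nondegenerate skew-symmetric invariant bilinear form. **Notation.** $L_\diamond(x)y=x\diamond y=R_\diamond(y)x$ for products on $A$ ($L_\rhd$, $R_\lhd$, etc. in (b) refer to $\rhd_A,\lhd_A$); $\mathcal L_\rhd,\mathcal R_\rhd,\mathcal L_\lhd,\mathcal R_\lhd:A^*\to\mathrm{End}(A^* )$ are the corresponding left and right multiplications for $\rhd_{A^*},\lhd_{A^*}$. For linear $\varphi:A\to\mathrm{End}(V)$, $\varphi^*:A\to\mathrm{End}(V^* )$ is given by $\langle\varphi^*(x)v^*,u\rangle=-\langle v^*,\varphi(x)u\rangle$; likewise for maps on $A^*$, with $A^{**}=A$. $\tau(x\otimes y)=y\otimes x$. Linear duals: $\langle a^*\rhd_{A^*}b^*,x\rangle=\langle a^*\otimes b^*,\delta_{\rhd}(x)\rangle$, $\langle a^*\lhd_{A^*}b^*,x\rangle=\langle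 a^*\otimes b^*,\delta_{\lhd}(x)\rangle$. **Double construction.** A double construction of Frobenius dialgebra associated to $(A,\rhd_A,\lhd_A)$ and $(A^*,\rhd_{A^*},\lhd_{A^*})$ is a dialgebra structure on $A\oplus A^*$ containing both $A$ and $A^*$ as dialgebra subalgebras such that the form $\mathfrak{B}_d(x+a^*,y+b^* )=\langle y,a^*\rangle-\langle x,b^*\rangle$ is invariant (so that $A\oplus A^*$ with $\mathfrak{B}_d$ is a skew-symmetric Frobenius dialgebra). **Bimodules.** A bimodule of an associative algebra $(A,\cdot)$ is $(V;l,r)$ with linear $l,r:A\to\mathrm{End}(V)$, $l(x\cdot y)=l(x)l(y)$, $r(x\cdot y)=r(y)r(x)$, $l(x)r(y)=r(y)l(x)$. A bimodule of a dialgebra is $(V;l_{\rhd},r_{\rhd},l_{\lhd},r_{\lhd})$ where $(V;l_{\rhd},r_{\rhd})$, $(V;l_{\lhd},r_{\lhd})$ are bimodules of $(A,\rhd)$, $(A,\lhd)$ and $r_{\lhd}(x\lhd y)=r_{\lhd}(x\rhd y)$, $l_{\lhd}(x)r_{\lhd}(y)=l_{\lhd}(x)r_{\rhd}(y)$, $l_{\lhd}(x)l_{\lhd}(y)=l_{\lhd}(x)l_{\rhd}(y)$, $r_{\lhd}(x)r_{\rhd}(y)=r_{\rhd}(y\lhd x)$, $r_{\lhd}(x)l_{\rhd}(y)=l_{\rhd}(y)r_{\lhd}(x)$, $l_{\lhd}(x\rhd y)=l_{\rhd}(x)l_{\lhd}(y)$, $r_{\rhd}(x)r_{\lhd}(y)=r_{\rhd}(x)r_{\rhd}(y)$,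 $r_{\rhd}(x)l_{\lhd}(y)=r_{\rhd}(x)l_{\rhd}(y)$, $l_{\rhd}(x\lhd y)=l_{\rhd}(x\rhd y)$. **Matched pair of associative algebras.** $(A,B,l_A,r_A,l_B,r_B)$ where $(B;l_A,r_A)$ is a bimodule of $(A,\cdot_A)$, $(A;l_B,r_B)$ is a bimodule of $(B,\cdot_B)$, and for $x,y\in A$, $a,b\in B$: $l_A(x)(a\cdot_B b)=l_A(r_B(a)x)b+(l_A(x)a)\cdot_B b$, $r_A(x)(a\cdot_B b)=r_A(l_B(b)x)a+a\cdot_B(r_A(x)b)$, $l_B(a)(x\cdot_A y)=l_B(r_A(x)a)y+(l_B(a)x)\cdot_A y$, $r_B(a)(x\cdot_A y)=r_B(l_A(y)a)x+x\cdot_A(r_B(a)y)$, $l_A(l_B(a)x)b+(r_A(x)a)\cdot_B b=r_A(r_B(b)x)a+a\cdot_B(l_A(x)b)$, $l_B(l_A(x)a)y+(r_B(a)x)\cdot_A y=r_B(r_A(y)a)x+x\cdot_A(l_B(a)y)$. **Matched pair of dialgebras.** $(A,B,l_{\rhd_A},r_{\rhd_A},l_{\lhd_A},r_{\lhd_A},l_{\rhd_B},r_{\rhd_B},l_{\lhd_B},r_{\lhd_B})$, for dialgebras $A,B$, where $(B;l_{\rhd_A},r_{\rhd_A},l_{\lhd_A},r_{\lhd_A})$ is a bimodule of the dialgebra $A$, $(A;l_{\rhd_B},r_{\rhd_B},l_{\lhd_B},r_{\lhd_B})$ is a bimodule of the dialgebra $B$, $(A,B,l_{\rhd_A},r_{\rhd_A},l_{\rhd_B},r_{\rhd_B})$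 and $(A,B,l_{\lhd_A},r_{\lhd_A},l_{\lhd_B},r_{\lhd_B})$ are matched pairs of associative algebras (for the products $\rhd$ and $\lhd$ respectively), and for all $x,y\in A$, $a,b\in B$: 1. $x\lhd_A(l_{\lhd_B}(a)y)+r_{\lhd_B}(r_{\lhd_A}(y)a)x=x\lhd_A(l_{\rhd_B}(a)y)+r_{\lhd_B}(r_{\rhd_A}(y)a)x$; 2. $x\lhd_A(r_{\lhd_B}(a)y)+r_{\lhd_B}(l_{\lhd_A}(y)a)x=x\lhd_A(r_{\rhd_B}(a)y)+r_{\lhd_B}(l_{\rhd_A}(y)a)x$; 3. $l_{\lhd_A}(x)(a\lhd_B b)=l_{\lhd_A}(x)(a\rhd_B b)$; 4. $a\lhd_B(l_{\lhd_A}(x)b)+r_{\lhd_A}(r_{\lhd_B}(b)x)a=a\lhd_B(l_{\rhd_A}(x)b)+r_{\lhd_A}(r_{\rhd_B}(b)x)a$; 5. $a\lhd_B(r_{\lhd_A}(x)b)+r_{\lhd_A}(l_{\lhd_B}(b)x)a=a\lhd_B(r_{\rhd_A}(x)b)+r_{\lhd_A}(l_{\rhd_B}(b)x)a$; 6. $l_{\lhd_B}(a)(x\lhd_A y)=l_{\lhd_B}(a)(x\rhd_A y)$; 7. $l_{\rhd_B}(a)(x\lhd_A y)=(l_{\rhd_B}(a)x)\lhd_A y+l_{\lhd_B}(r_{\rhd_A}(x)a)y$; 8. $(r_{\rhd_B}(a)x)\lhd_A y+l_{\lhd_B}(l_{\rhd_A}(x)a)y=x\rhd_A(l_{\lhd_B}(a)y)+r_{\rhd_B}(r_{\lhd_A}(y)a)x$;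 9. $r_{\lhd_B}(a)(x\rhd_A y)=x\rhd_A(r_{\lhd_B}(a)y)+r_{\rhd_B}(l_{\lhd_A}(y)a)x$; 10. $l_{\rhd_A}(x)(a\lhd_B b)=(l_{\rhd_A}(x)a)\lhd_B b+l_{\lhd_A}(r_{\rhd_B}(a)x)b$; 11. $(r_{\rhd_A}(x)a)\lhd_B b+l_{\lhd_A}(l_{\rhd_B}(a)x)b=a\rhd_B(l_{\lhd_A}(x)b)+r_{\rhd_A}(r_{\lhd_B}(b)x)a$; 12. $r_{\lhd_A}(x)(a\rhd_B b)=a\rhd_B(r_{\lhd_A}(x)b)+r_{\rhd_A}(l_{\lhd_B}(b)x)a$; 13. $(l_{\lhd_B}(a)x)\rhd_A y+l_{\rhd_B}(r_{\lhd_A}(x)a)y=(l_{\rhd_B}(a)x)\rhd_A y+l_{\rhd_B}(r_{\rhd_A}(x)a)y$; 14. $(r_{\lhd_B}(a)x)\rhd_A y+l_{\rhd_B}(l_{\lhd_A}(x)a)y=(r_{\rhd_B}(a)x)\rhd_A y+l_{\rhd_B}(l_{\rhd_A}(x)a)y$; 15. $r_{\rhd_B}(a)(x\lhd_A y)=r_{\rhd_B}(a)(x\rhd_A y)$; 16. $(l_{\lhd_A}(x)a)\rhd_B b+l_{\rhd_A}(r_{\lhd_B}(a)x)b=(l_{\rhd_A}(x)a)\rhd_B b+l_{\rhd_A}(r_{\rhd_B}(a)x)b$; 17. $(r_{\lhd_A}(x)a)\rhd_B b+l_{\rhd_A}(l_{\lhd_B}(a)x)b=(r_{\rhd_A}(x)a)\rhd_B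 b+l_{\rhd_A}(l_{\rhd_B}(a)x)b$; 18. $r_{\rhd_A}(x)(a\lhd_B b)=r_{\rhd_A}(x)(a\rhd_B b)$. **Co-dialgebra.** $(A,\delta_{\rhd},\delta_{\lhd})$ with $\delta_{\rhd},\delta_{\lhd}:A\to A\otimes A$ linear and coassociative, $(\mathrm{id}\otimes\delta)\delta=(\delta\otimes\mathrm{id})\delta$, and $(\mathrm{id}\otimes\delta_{\lhd})\delta_{\lhd}=(\mathrm{id}\otimes\delta_{\rhd})\delta_{\lhd}$, $(\delta_{\rhd}\otimes\mathrm{id})\delta_{\lhd}=(\mathrm{id}\otimes\delta_{\lhd})\delta_{\rhd}$, $(\delta_{\lhd}\otimes\mathrm{id})\delta_{\rhd}=(\delta_{\rhd}\otimes\mathrm{id})\delta_{\rhd}$. **Bi-dialgebra.** $(A,\rhd,\lhd,\delta_{\rhd},\delta_{\lhd})$ with $(A,\rhd,\lhd)$ a dialgebra, $(A,\delta_{\rhd},\delta_{\lhd})$ a co-dialgebra, and, with $x\star y=x\rhd y-x\lhd y$ and $\delta_\star=\delta_{\rhd}-\delta_{\lhd}$, for all $x,y\in A$: $(\mathrm{id}\otimes L_{\lhd}(x))\delta_{\lhd}(y)=(R_{\rhd}(y)\otimes\mathrm{id})\delta_{\rhd}(x)$; $(L_{\lhd}(x)\otimes\mathrm{id})\delta_{\rhd}(y)=(\mathrm{id}\otimes L_{\lhd}(y))\tau\delta_{\rhd}(x)$; $(R_{\rhd}(x)\otimes\mathrm{id})\tau\delta_{\lhd}(y)=(\mathrm{id}\otimes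 R_{\rhd}(y))\delta_{\lhd}(x)$; $\delta_{\rhd}(x\rhd y)=(\mathrm{id}\otimes L_{\rhd}(x))\delta_{\rhd}(y)-(R_{\star}(y)\otimes\mathrm{id})\delta_{\star}(x)$; $\delta_{\rhd}(x\lhd y)=(\mathrm{id}\otimes L_{\lhd}(x))\delta_{\star}(y)+(R_{\lhd}(y)\otimes\mathrm{id})\delta_{\rhd}(x)$; $\delta_{\lhd}(x\rhd y)=(\mathrm{id}\otimes L_{\star}(x))\delta_{\lhd}(y)+(R_{\rhd}(y)\otimes\mathrm{id})\delta_{\lhd}(x)$; $\delta_{\lhd}(x\lhd y)=(R_{\lhd}(y)\otimes\mathrm{id})\delta_{\lhd}(x)-(\mathrm{id}\otimes L_{\star}(x))\delta_{\star}(y)$; $(L_{\star}(x)\otimes\mathrm{id})\delta_{\rhd}(y)+(\mathrm{id}\otimes L_{\lhd}(y))\tau\delta_{\lhd}(x)=(R_{\star}(y)\otimes\mathrm{id})\tau\delta_{\star}(x)+(\mathrm{id}\otimes R_{\lhd}(x))\delta_{\rhd}(y)$; $(R_{\lhd}(x)\otimes\mathrm{id})\tau\delta_{\lhd}(y)+(\mathrm{id}\otimes R_{\rhd}(y))\delta_{\star}(x)=(L_{\star}(y)\otimes\mathrm{id})\delta_{\star}(x)+(\mathrm{id}\otimes L_{\rhd}(x))\tau\delta_{\lhd}(y)$. *)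

theory Defs
  imports Complex_Main "HOL-Library.Function_Algebras" "HOL-Library.Product_Plus"
begin

text \<open>
  A vector space \<open>A\<close> over a field is an arbitrary type with a scalar multiplication \<open>s\<close>.
  Its dual and its tensor powers are subspaces of function types, and \<open>A \<oplus> A\<^sup>*\<close> is a
  subspace of a product type; therefore the notions below are relative to a carrier set.
  Sums and differences of functions and pairs are the componentwise ones of the library.
\<close>

section \<open>Linear algebra\<close>

definition fun_scale :: "('f \<Rightarrow> 'v \<Rightarrow> 'v) \<Rightarrow> 'f \<Rightarrow> ('i \<Rightarrow> 'v) \<Rightarrow> ('i \<Rightarrow> 'v)" where
  "fun_scale s c f = (\<lambda>i. s c (f i))"

definition prod_scale ::
  "('f \<Rightarrow> 'v \<Rightarrow> 'v) \<Rightarrow> ('f \<Rightarrow> 'w \<Rightarrow> 'w) \<Rightarrow> 'f \<Rightarrow> 'v \<times> 'w \<Rightarrow> 'v \<times> 'w" where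
  "prod_scale s t c p = (s c (fst p), t c (snd p))"

definition linear_on ::
  "'v::ab_group_add set \<Rightarrow> ('f::field \<Rightarrow> 'v \<Rightarrow> 'v) \<Rightarrow> ('f \<Rightarrow> 'w::ab_group_add \<Rightarrow> 'w) \<Rightarrow>
   ('v \<Rightarrow> 'w) \<Rightarrow> bool" where
  "linear_on V s t f \<longleftrightarrow>
     (\<forall>x\<in>V. \<forall>y\<in>V. f (x + y) = f x + f y) \<and> (\<forall>c. \<forall>x\<in>V. f (s c x) = t c (f x))"

definition bilinear_on ::
  "'v::ab_group_add set \<Rightarrow> ('f::field \<Rightarrow> 'v \<Rightarrow> 'v) \<Rightarrow> 'w::ab_group_add set \<Rightarrow> ('f \<Rightarrow> 'w \<Rightarrow> 'w) \<Rightarrow>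
   'u::ab_group_add set \<Rightarrow> ('f \<Rightarrow> 'u \<Rightarrow> 'u) \<Rightarrow> ('v \<Rightarrow> 'w \<Rightarrow> 'u) \<Rightarrow> bool" where
  "bilinear_on V s W t U u m \<longleftrightarrow>
     (\<forall>x\<in>V. \<forall>y\<in>W. m x y \<in> U) \<and>
     (\<forall>x\<in>V. linear_on W t u (m x)) \<and> (\<forall>y\<in>W. linear_on V s u (\<lambda>x. m x y))"

definition dual_space :: "('f::field \<Rightarrow> 'a::ab_group_add \<Rightarrow> 'a) \<Rightarrow> ('a \<Rightarrow> 'f) set" where
  "dual_space s = {f. Vector_Spaces.linear s (*) f}"

abbreviation dual_scale :: "'f::field \<Rightarrow> ('a \<Rightarrow> 'f) \<Rightarrow> ('a \<Rightarrow> 'f)" where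
  "dual_scale \<equiv> fun_scale (*)"

text \<open>
  \<open>\<phi>\<^sup>*\<close> for \<open>\<phi> : A \<rightarrow> End(A)\<close>, and \<open>\<phi>\<^sup>*\<close> for \<open>\<phi> : A\<^sup>* \<rightarrow> End(A\<^sup>*)\<close>; the latter takes values in
  \<open>End(A\<^sup>*\<^sup>*)\<close>, where \<open>A\<^sup>*\<^sup>*\<close> is identified with \<open>A\<close>: \<open>y\<close> is the element of \<open>A\<close> whose
  evaluation functional is \<open>v \<mapsto> - \<langle>x, \<phi>(a) v\<rangle>\<close>.
\<close>

definition dual_rep :: "('a \<Rightarrow> 'a \<Rightarrow> 'a) \<Rightarrow> 'a \<Rightarrow> ('a \<Rightarrow> 'f::field) \<Rightarrow> ('a \<Rightarrow> 'f)" where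
  "dual_rep \<phi> x v = (\<lambda>u. - v (\<phi> x u))"

definition codual_rep ::
  "('f::field \<Rightarrow> 'a::ab_group_add \<Rightarrow> 'a) \<Rightarrow> (('a \<Rightarrow> 'f) \<Rightarrow> ('a \<Rightarrow> 'f) \<Rightarrow> ('a \<Rightarrow> 'f)) \<Rightarrow>
   ('a \<Rightarrow> 'f) \<Rightarrow> 'a \<Rightarrow> 'a" where
  "codual_rep s \<phi> a x = (THE y. \<forall>v\<in>dual_space s. v y = - \<phi> a v x)"

definition L_mult :: "('v \<Rightarrow> 'v \<Rightarrow> 'v) \<Rightarrow> 'v \<Rightarrow> 'v \<Rightarrow> 'v" where
  "L_mult m x y = m x y"

definition R_mult :: "('v \<Rightarrow> 'v \<Rightarrow> 'v) \<Rightarrow> 'v \<Rightarrow> 'v \<Rightarrow> 'v" where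
  "R_mult m y x = m x y"

section \<open>Tensor powers\<close>

text \<open>
  For finite-dimensional \<open>A\<close>, the space \<open>A \<otimes> A\<close> is modelled by the bilinear forms on
  \<open>A\<^sup>* \<times> A\<^sup>*\<close>, and \<open>A \<otimes> A \<otimes> A\<close> correspondingly by trilinear forms.  Forms are
  extended by \<open>0\<close> outside the dual space, so that equality of tensors is equality of
  functions.  The universal property is proved below.
\<close>

type_synonym ('a, 'f) tensor2 = "('a \<Rightarrow> 'f) \<Rightarrow> ('a \<Rightarrow> 'f) \<Rightarrow> 'f"
type_synonym ('a, 'f) tensor3 = "('a \<Rightarrow> 'f) \<Rightarrow> ('a \<Rightarrow> 'f) \<Rightarrow> ('a \<Rightarrow> 'f) \<Rightarrow> 'f"

definition tensor2_space ::
  "('f::field \<Rightarrow> 'a::ab_group_add \<Rightarrow> 'a) \<Rightarrow> ('a, 'f) tensor2 set" where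
  "tensor2_space s = {t.
     bilinear_on (dual_space s) dual_scale (dual_space s) dual_scale UNIV (*) t \<and>
     (\<forall>a b. a \<notin> dual_space s \<or> b \<notin> dual_space s \<longrightarrow> t a b = 0)}"

abbreviation tensor2_scale :: "'f::field \<Rightarrow> ('a, 'f) tensor2 \<Rightarrow> ('a, 'f) tensor2" where
  "tensor2_scale \<equiv> fun_scale (fun_scale (*))"

definition pure_tensor ::
  "('f::field \<Rightarrow> 'a::ab_group_add \<Rightarrow> 'a) \<Rightarrow> 'a \<Rightarrow> 'a \<Rightarrow> ('a, 'f) tensor2" where
  "pure_tensor s x y =
     (\<lambda>a b. if a \<in> dual_space s \<and> b \<in> dual_space s then a x * b y else 0)"

text \<open>The canonical pairing of \<open>A\<^sup>* \<otimes> A\<^sup>*\<close> with \<open>A \<otimes> A\<close>, on \<open>a \<otimes> b\<close>.\<close>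

definition tensor2_pairing :: "('a \<Rightarrow> 'f) \<Rightarrow> ('a \<Rightarrow> 'f) \<Rightarrow> ('a, 'f) tensor2 \<Rightarrow> 'f" where
  "tensor2_pairing a b t = t a b"

text \<open>\<open>f \<otimes> g\<close>, \<open>\<tau>\<close>, \<open>id \<otimes> \<delta>\<close> and \<open>\<delta> \<otimes> id\<close>; see below for their values on pure tensors.\<close>

definition tensor_map ::
  "('f::field \<Rightarrow> 'a::ab_group_add \<Rightarrow> 'a) \<Rightarrow> ('a \<Rightarrow> 'a) \<Rightarrow> ('a \<Rightarrow> 'a) \<Rightarrow>
   ('a, 'f) tensor2 \<Rightarrow> ('a, 'f) tensor2" where
  "tensor_map s f g t =
     (\<lambda>a b. if a \<in> dual_space s \<and> b \<in> dual_space s then t (a \<circ> f) (b \<circ> g) else 0)"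

definition tensor_swap :: "('a, 'f) tensor2 \<Rightarrow> ('a, 'f) tensor2" where
  "tensor_swap t = (\<lambda>a b. t b a)"

definition id_tensor_co :: "('a \<Rightarrow> ('a, 'f) tensor2) \<Rightarrow> ('a, 'f) tensor2 \<Rightarrow> ('a, 'f) tensor3" where
  "id_tensor_co \<delta> t = (\<lambda>a b c. t a (\<lambda>x. \<delta> x b c))"

definition co_tensor_id :: "('a \<Rightarrow> ('a, 'f) tensor2) \<Rightarrow> ('a, 'f) tensor2 \<Rightarrow> ('a, 'f) tensor3" where
  "co_tensor_id \<delta> t = (\<lambda>a b c. t (\<lambda>x. \<delta> x a b) c)"

definition linear_dual ::
  "('f::field \<Rightarrow> 'a::ab_group_add \<Rightarrow> 'a) \<Rightarrow> (('a \<Rightarrow> 'f) \<Rightarrow> ('a \<Rightarrow> 'f) \<Rightarrow> ('a \<Rightarrow> 'f)) \<Rightarrow>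
   ('a \<Rightarrow> ('a, 'f) tensor2) \<Rightarrow> bool" where
  "linear_dual s m \<delta> \<longleftrightarrow>
     Vector_Spaces.linear s tensor2_scale \<delta> \<and> range \<delta> \<subseteq> tensor2_space s \<and>
     (\<forall>a\<in>dual_space s. \<forall>b\<in>dual_space s. \<forall>x. m a b x = tensor2_pairing a b (\<delta> x))"

section \<open>Dialgebras\<close>

locale assoc_algebra = vector_space s
  for s :: "'f::field \<Rightarrow> 'v::ab_group_add \<Rightarrow> 'v" +
  fixes V :: "'v set" and mult :: "'v \<Rightarrow> 'v \<Rightarrow> 'v" (infixl \<open>\<cdot>\<close> 70)
  assumes carrier_subspace: "module.subspace s V"
    and mult_bilinear: "bilinear_on V s V s V s (\<cdot>)"
    and mult_assoc: "\<lbrakk>x \<in> V; y \<in> V; z \<in> V\<rbrakk> \<Longrightarrow> (x \<cdot> y) \<cdot> z = x \<cdot> (y \<cdot> z)"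

locale dialgebra = R: assoc_algebra s V dr + L: assoc_algebra s V dl
  for s :: "'f::field \<Rightarrow> 'v::ab_group_add \<Rightarrow> 'v" and V :: "'v set"
    and dr :: "'v \<Rightarrow> 'v \<Rightarrow> 'v" (infixl \<open>\<rhd>\<close> 70) and dl :: "'v \<Rightarrow> 'v \<Rightarrow> 'v" (infixl \<open>\<lhd>\<close> 70) +
  assumes left_left: "\<lbrakk>x \<in> V; y \<in> V; z \<in> V\<rbrakk> \<Longrightarrow> (x \<lhd> y) \<lhd> z = x \<lhd> (y \<rhd> z)"
    and right_left: "\<lbrakk>x \<in> V; y \<in> V; z \<in> V\<rbrakk> \<Longrightarrow> (x \<rhd> y) \<lhd> z = x \<rhd> (y \<lhd> z)"
    and left_right: "\<lbrakk>x \<in> V; y \<in> V; z \<in> V\<rbrakk> \<Longrightarrow> (x \<lhd> y) \<rhd> z = x \<rhd> (y \<rhd> z)"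

definition invariant_form ::
  "'v::ab_group_add set \<Rightarrow> ('v \<Rightarrow> 'v \<Rightarrow> 'v) \<Rightarrow> ('v \<Rightarrow> 'v \<Rightarrow> 'v) \<Rightarrow> ('v \<Rightarrow> 'v \<Rightarrow> 'f) \<Rightarrow> bool" where
  "invariant_form V dr dl \<beta> \<longleftrightarrow>
     (\<forall>x\<in>V. \<forall>y\<in>V. \<forall>z\<in>V.
        \<beta> (dr x y) z = \<beta> x (dr y z - dl y z) \<and> \<beta> (dl x y) z = \<beta> x (dr y z))"

locale skew_frobenius_dialgebra = dialgebra s V dr dl
  for s :: "'f::field \<Rightarrow> 'v::ab_group_add \<Rightarrow> 'v" and V dr dl +
  fixes \<beta> :: "'v \<Rightarrow> 'v \<Rightarrow> 'f"
  assumes form_bilinear: "bilinear_on V s V s UNIV (*) \<beta>"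
    and form_skew: "\<lbrakk>x \<in> V; y \<in> V\<rbrakk> \<Longrightarrow> \<beta> x y = - \<beta> y x"
    and form_nondegenerate: "\<lbrakk>x \<in> V; \<forall>y\<in>V. \<beta> x y = 0\<rbrakk> \<Longrightarrow> x = 0"
    and form_invariant: "invariant_form V dr dl \<beta>"

definition double_form :: "'a \<times> ('a \<Rightarrow> 'f::field) \<Rightarrow> 'a \<times> ('a \<Rightarrow> 'f) \<Rightarrow> 'f" where
  "double_form p q = snd p (fst q) - snd q (fst p)"

definition double_construction ::
  "('f::field \<Rightarrow> 'a::ab_group_add \<Rightarrow> 'a) \<Rightarrow> ('a \<Rightarrow> 'a \<Rightarrow> 'a) \<Rightarrow> ('a \<Rightarrow> 'a \<Rightarrow> 'a) \<Rightarrow>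
   (('a \<Rightarrow> 'f) \<Rightarrow> ('a \<Rightarrow> 'f) \<Rightarrow> ('a \<Rightarrow> 'f)) \<Rightarrow> (('a \<Rightarrow> 'f) \<Rightarrow> ('a \<Rightarrow> 'f) \<Rightarrow> ('a \<Rightarrow> 'f)) \<Rightarrow>
   ('a \<times> ('a \<Rightarrow> 'f) \<Rightarrow> 'a \<times> ('a \<Rightarrow> 'f) \<Rightarrow> 'a \<times> ('a \<Rightarrow> 'f)) \<Rightarrow>
   ('a \<times> ('a \<Rightarrow> 'f) \<Rightarrow> 'a \<times> ('a \<Rightarrow> 'f) \<Rightarrow> 'a \<times> ('a \<Rightarrow> 'f)) \<Rightarrow> bool" where
  "double_construction s drA dlA drB dlB dr dl \<longleftrightarrow>
     dialgebra (prod_scale s dual_scale) (UNIV \<times> dual_space s) dr dl \<and>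
     (\<forall>x y. dr (x, 0) (y, 0) = (drA x y, 0) \<and> dl (x, 0) (y, 0) = (dlA x y, 0)) \<and>
     (\<forall>a\<in>dual_space s. \<forall>b\<in>dual_space s.
        dr (0, a) (0, b) = (0, drB a b) \<and> dl (0, a) (0, b) = (0, dlB a b)) \<and>
     invariant_form (UNIV \<times> dual_space s) dr dl double_form"

section \<open>Bimodules and matched pairs\<close>

locale assoc_bimodule = Alg: assoc_algebra s A mult + Mod: vector_space t
  for s :: "'f::field \<Rightarrow> 'a::ab_group_add \<Rightarrow> 'a" and A :: "'a set"
    and mult :: "'a \<Rightarrow> 'a \<Rightarrow> 'a" (infixl \<open>\<cdot>\<close> 70)
    and t :: "'f \<Rightarrow> 'v::ab_group_add \<Rightarrow> 'v" +
  fixes V :: "'v set" and l r :: "'a \<Rightarrow> 'v \<Rightarrow> 'v"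
  assumes module_subspace: "module.subspace t V"
    and l_linear: "bilinear_on A s V t V t l"
    and r_linear: "bilinear_on A s V t V t r"
    and l_mult: "\<lbrakk>x \<in> A; y \<in> A; v \<in> V\<rbrakk> \<Longrightarrow> l (x \<cdot> y) v = l x (l y v)"
    and r_mult: "\<lbrakk>x \<in> A; y \<in> A; v \<in> V\<rbrakk> \<Longrightarrow> r (x \<cdot> y) v = r y (r x v)"
    and l_r_commute: "\<lbrakk>x \<in> A; y \<in> A; v \<in> V\<rbrakk> \<Longrightarrow> l x (r y v) = r y (l x v)"

locale dialgebra_bimodule =
  Alg: dialgebra s A dr dl +
  R: assoc_bimodule s A dr t V lr rr +
  L: assoc_bimodule s A dl t V ll rl
  for s :: "'f::field \<Rightarrow> 'a::ab_group_add \<Rightarrow> 'a" and A :: "'a set"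
    and dr :: "'a \<Rightarrow> 'a \<Rightarrow> 'a" (infixl \<open>\<rhd>\<close> 70) and dl :: "'a \<Rightarrow> 'a \<Rightarrow> 'a" (infixl \<open>\<lhd>\<close> 70)
    and t :: "'f \<Rightarrow> 'v::ab_group_add \<Rightarrow> 'v" and V :: "'v set"
    and lr :: "'a \<Rightarrow> 'v \<Rightarrow> 'v" (\<open>l\<^sub>\<rhd>\<close>) and rr :: "'a \<Rightarrow> 'v \<Rightarrow> 'v" (\<open>r\<^sub>\<rhd>\<close>)
    and ll :: "'a \<Rightarrow> 'v \<Rightarrow> 'v" (\<open>l\<^sub>\<lhd>\<close>) and rl :: "'a \<Rightarrow> 'v \<Rightarrow> 'v" (\<open>r\<^sub>\<lhd>\<close>) +
  assumes bimod1: "\<lbrakk>x \<in> A; y \<in> A; v \<in> V\<rbrakk> \<Longrightarrow> r\<^sub>\<lhd> (x \<lhd> y) v = r\<^sub>\<lhd> (x \<rhd> y) v"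
    and bimod2: "\<lbrakk>x \<in> A; y \<in> A; v \<in> V\<rbrakk> \<Longrightarrow> l\<^sub>\<lhd> x (r\<^sub>\<lhd> y v) = l\<^sub>\<lhd> x (r\<^sub>\<rhd> y v)"
    and bimod3: "\<lbrakk>x \<in> A; y \<in> A; v \<in> V\<rbrakk> \<Longrightarrow> l\<^sub>\<lhd> x (l\<^sub>\<lhd> y v) = l\<^sub>\<lhd> x (l\<^sub>\<rhd> y v)"
    and bimod4: "\<lbrakk>x \<in> A; y \<in> A; v \<in> V\<rbrakk> \<Longrightarrow> r\<^sub>\<lhd> x (r\<^sub>\<rhd> y v) = r\<^sub>\<rhd> (y \<lhd> x) v"
    and bimod5: "\<lbrakk>x \<in> A; y \<in> A; v \<in> V\<rbrakk> \<Longrightarrow> r\<^sub>\<lhd> x (l\<^sub>\<rhd> y v) = l\<^sub>\<rhd> y (r\<^sub>\<lhd> x v)"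
    and bimod6: "\<lbrakk>x \<in> A; y \<in> A; v \<in> V\<rbrakk> \<Longrightarrow> l\<^sub>\<lhd> (x \<rhd> y) v = l\<^sub>\<rhd> x (l\<^sub>\<lhd> y v)"
    and bimod7: "\<lbrakk>x \<in> A; y \<in> A; v \<in> V\<rbrakk> \<Longrightarrow> r\<^sub>\<rhd> x (r\<^sub>\<lhd> y v) = r\<^sub>\<rhd> x (r\<^sub>\<rhd> y v)"
    and bimod8: "\<lbrakk>x \<in> A; y \<in> A; v \<in> V\<rbrakk> \<Longrightarrow> r\<^sub>\<rhd> x (l\<^sub>\<lhd> y v) = r\<^sub>\<rhd> x (l\<^sub>\<rhd> y v)"
    and bimod9: "\<lbrakk>x \<in> A; y \<in> A; v \<in> V\<rbrakk> \<Longrightarrow> l\<^sub>\<rhd> (x \<lhd> y) v = l\<^sub>\<rhd> (x \<rhd> y) v"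

locale assoc_matched_pair =
  ModB: assoc_bimodule sA A multA sB B lA rA +
  ModA: assoc_bimodule sB B multB sA A lB rB
  for sA :: "'f::field \<Rightarrow> 'a::ab_group_add \<Rightarrow> 'a" and A :: "'a set"
    and multA :: "'a \<Rightarrow> 'a \<Rightarrow> 'a" (infixl \<open>\<cdot>\<^sub>A\<close> 70)
    and sB :: "'f \<Rightarrow> 'b::ab_group_add \<Rightarrow> 'b" and B :: "'b set"
    and multB :: "'b \<Rightarrow> 'b \<Rightarrow> 'b" (infixl \<open>\<cdot>\<^sub>B\<close> 70)
    and lA :: "'a \<Rightarrow> 'b \<Rightarrow> 'b" (\<open>l\<^sub>A\<close>) and rA :: "'a \<Rightarrow> 'b \<Rightarrow> 'b" (\<open>r\<^sub>A\<close>)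
    and lB :: "'b \<Rightarrow> 'a \<Rightarrow> 'a" (\<open>l\<^sub>B\<close>) and rB :: "'b \<Rightarrow> 'a \<Rightarrow> 'a" (\<open>r\<^sub>B\<close>) +
  assumes match1: "\<lbrakk>x \<in> A; a \<in> B; b \<in> B\<rbrakk> \<Longrightarrow>
      l\<^sub>A x (a \<cdot>\<^sub>B b) = l\<^sub>A (r\<^sub>B a x) b + l\<^sub>A x a \<cdot>\<^sub>B b"
    and match2: "\<lbrakk>x \<in> A; a \<in> B; b \<in> B\<rbrakk> \<Longrightarrow>
      r\<^sub>A x (a \<cdot>\<^sub>B b) = r\<^sub>A (l\<^sub>B b x) a + a \<cdot>\<^sub>B r\<^sub>A x b"
    and match3: "\<lbrakk>x \<in> A; y \<in> A; a \<in> B\<rbrakk> \<Longrightarrow>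
      l\<^sub>B a (x \<cdot>\<^sub>A y) = l\<^sub>B (r\<^sub>A x a) y + l\<^sub>B a x \<cdot>\<^sub>A y"
    and match4: "\<lbrakk>x \<in> A; y \<in> A; a \<in> B\<rbrakk> \<Longrightarrow>
      r\<^sub>B a (x \<cdot>\<^sub>A y) = r\<^sub>B (l\<^sub>A y a) x + x \<cdot>\<^sub>A r\<^sub>B a y"
    and match5: "\<lbrakk>x \<in> A; a \<in> B; b \<in> B\<rbrakk> \<Longrightarrow>
      l\<^sub>A (l\<^sub>B a x) b + r\<^sub>A x a \<cdot>\<^sub>B b = r\<^sub>A (r\<^sub>B b x) a + a \<cdot>\<^sub>B l\<^sub>A x b"
    and match6: "\<lbrakk>x \<in> A; y \<in> A; a \<in> B\<rbrakk> \<Longrightarrow>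
      l\<^sub>B (l\<^sub>A x a) y + r\<^sub>B a x \<cdot>\<^sub>A y = r\<^sub>B (r\<^sub>A y a) x + x \<cdot>\<^sub>A l\<^sub>B a y"

locale dialgebra_matched_pair =
  ModB: dialgebra_bimodule sA A drA dlA sB B lrA rrA llA rlA +
  ModA: dialgebra_bimodule sB B drB dlB sA A lrB rrB llB rlB +
  R: assoc_matched_pair sA A drA sB B drB lrA rrA lrB rrB +
  L: assoc_matched_pair sA A dlA sB B dlB llA rlA llB rlB
  for sA :: "'f::field \<Rightarrow> 'a::ab_group_add \<Rightarrow> 'a" and A :: "'a set"
    and drA :: "'a \<Rightarrow> 'a \<Rightarrow> 'a" (infixl \<open>\<rhd>\<^sub>A\<close> 70) and dlA :: "'a \<Rightarrow> 'a \<Rightarrow> 'a" (infixl \<open>\<lhd>\<^sub>A\<close> 70)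
    and sB :: "'f \<Rightarrow> 'b::ab_group_add \<Rightarrow> 'b" and B :: "'b set"
    and drB :: "'b \<Rightarrow> 'b \<Rightarrow> 'b" (infixl \<open>\<rhd>\<^sub>B\<close> 70) and dlB :: "'b \<Rightarrow> 'b \<Rightarrow> 'b" (infixl \<open>\<lhd>\<^sub>B\<close> 70)
    and lrA :: "'a \<Rightarrow> 'b \<Rightarrow> 'b" (\<open>l\<^bsub>\<rhd>A\<^esub>\<close>) and rrA :: "'a \<Rightarrow> 'b \<Rightarrow> 'b" (\<open>r\<^bsub>\<rhd>A\<^esub>\<close>)
    and llA :: "'a \<Rightarrow> 'b \<Rightarrow> 'b" (\<open>l\<^bsub>\<lhd>A\<^esub>\<close>) and rlA :: "'a \<Rightarrow> 'b \<Rightarrow> 'b" (\<open>r\<^bsub>\<lhd>A\<^esub>\<close>)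
    and lrB :: "'b \<Rightarrow> 'a \<Rightarrow> 'a" (\<open>l\<^bsub>\<rhd>B\<^esub>\<close>) and rrB :: "'b \<Rightarrow> 'a \<Rightarrow> 'a" (\<open>r\<^bsub>\<rhd>B\<^esub>\<close>)
    and llB :: "'b \<Rightarrow> 'a \<Rightarrow> 'a" (\<open>l\<^bsub>\<lhd>B\<^esub>\<close>) and rlB :: "'b \<Rightarrow> 'a \<Rightarrow> 'a" (\<open>r\<^bsub>\<lhd>B\<^esub>\<close>) +
  assumes dmatch1: "\<lbrakk>x \<in> A; y \<in> A; a \<in> B\<rbrakk> \<Longrightarrow>
      x \<lhd>\<^sub>A l\<^bsub>\<lhd>B\<^esub> a y + r\<^bsub>\<lhd>B\<^esub> (r\<^bsub>\<lhd>A\<^esub> y a) x = x \<lhd>\<^sub>A l\<^bsub>\<rhd>B\<^esub> a y + r\<^bsub>\<lhd>B\<^esub> (r\<^bsub>\<rhd>A\<^esub> y a) x"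
    and dmatch2: "\<lbrakk>x \<in> A; y \<in> A; a \<in> B\<rbrakk> \<Longrightarrow>
      x \<lhd>\<^sub>A r\<^bsub>\<lhd>B\<^esub> a y + r\<^bsub>\<lhd>B\<^esub> (l\<^bsub>\<lhd>A\<^esub> y a) x = x \<lhd>\<^sub>A r\<^bsub>\<rhd>B\<^esub> a y + r\<^bsub>\<lhd>B\<^esub> (l\<^bsub>\<rhd>A\<^esub> y a) x"
    and dmatch3: "\<lbrakk>x \<in> A; a \<in> B; b \<in> B\<rbrakk> \<Longrightarrow>
      l\<^bsub>\<lhd>A\<^esub> x (a \<lhd>\<^sub>B b) = l\<^bsub>\<lhd>A\<^esub> x (a \<rhd>\<^sub>B b)"
    and dmatch4: "\<lbrakk>x \<in> A; a \<in> B; b \<in> B\<rbrakk> \<Longrightarrow>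
      a \<lhd>\<^sub>B l\<^bsub>\<lhd>A\<^esub> x b + r\<^bsub>\<lhd>A\<^esub> (r\<^bsub>\<lhd>B\<^esub> b x) a = a \<lhd>\<^sub>B l\<^bsub>\<rhd>A\<^esub> x b + r\<^bsub>\<lhd>A\<^esub> (r\<^bsub>\<rhd>B\<^esub> b x) a"
    and dmatch5: "\<lbrakk>x \<in> A; a \<in> B; b \<in> B\<rbrakk> \<Longrightarrow>
      a \<lhd>\<^sub>B r\<^bsub>\<lhd>A\<^esub> x b + r\<^bsub>\<lhd>A\<^esub> (l\<^bsub>\<lhd>B\<^esub> b x) a = a \<lhd>\<^sub>B r\<^bsub>\<rhd>A\<^esub> x b + r\<^bsub>\<lhd>A\<^esub> (l\<^bsub>\<rhd>B\<^esub> b x) a"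
    and dmatch6: "\<lbrakk>x \<in> A; y \<in> A; a \<in> B\<rbrakk> \<Longrightarrow>
      l\<^bsub>\<lhd>B\<^esub> a (x \<lhd>\<^sub>A y) = l\<^bsub>\<lhd>B\<^esub> a (x \<rhd>\<^sub>A y)"
    and dmatch7: "\<lbrakk>x \<in> A; y \<in> A; a \<in> B\<rbrakk> \<Longrightarrow>
      l\<^bsub>\<rhd>B\<^esub> a (x \<lhd>\<^sub>A y) = l\<^bsub>\<rhd>B\<^esub> a x \<lhd>\<^sub>A y + l\<^bsub>\<lhd>B\<^esub> (r\<^bsub>\<rhd>A\<^esub> x a) y"
    and dmatch8: "\<lbrakk>x \<in> A; y \<in> A; a \<in> B\<rbrakk> \<Longrightarrow>
      r\<^bsub>\<rhd>B\<^esub> a x \<lhd>\<^sub>A y + l\<^bsub>\<lhd>B\<^esub> (l\<^bsub>\<rhd>A\<^esub> x a) y = x \<rhd>\<^sub>A l\<^bsub>\<lhd>B\<^esub> a y + r\<^bsub>\<rhd>B\<^esub> (r\<^bsub>\<lhd>A\<^esub> y a) x"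
    and dmatch9: "\<lbrakk>x \<in> A; y \<in> A; a \<in> B\<rbrakk> \<Longrightarrow>
      r\<^bsub>\<lhd>B\<^esub> a (x \<rhd>\<^sub>A y) = x \<rhd>\<^sub>A r\<^bsub>\<lhd>B\<^esub> a y + r\<^bsub>\<rhd>B\<^esub> (l\<^bsub>\<lhd>A\<^esub> y a) x"
    and dmatch10: "\<lbrakk>x \<in> A; a \<in> B; b \<in> B\<rbrakk> \<Longrightarrow>
      l\<^bsub>\<rhd>A\<^esub> x (a \<lhd>\<^sub>B b) = l\<^bsub>\<rhd>A\<^esub> x a \<lhd>\<^sub>B b + l\<^bsub>\<lhd>A\<^esub> (r\<^bsub>\<rhd>B\<^esub> a x) b"
    and dmatch11: "\<lbrakk>x \<in> A; a \<in> B; b \<in> B\<rbrakk> \<Longrightarrow>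
      r\<^bsub>\<rhd>A\<^esub> x a \<lhd>\<^sub>B b + l\<^bsub>\<lhd>A\<^esub> (l\<^bsub>\<rhd>B\<^esub> a x) b = a \<rhd>\<^sub>B l\<^bsub>\<lhd>A\<^esub> x b + r\<^bsub>\<rhd>A\<^esub> (r\<^bsub>\<lhd>B\<^esub> b x) a"
    and dmatch12: "\<lbrakk>x \<in> A; a \<in> B; b \<in> B\<rbrakk> \<Longrightarrow>
      r\<^bsub>\<lhd>A\<^esub> x (a \<rhd>\<^sub>B b) = a \<rhd>\<^sub>B r\<^bsub>\<lhd>A\<^esub> x b + r\<^bsub>\<rhd>A\<^esub> (l\<^bsub>\<lhd>B\<^esub> b x) a"
    and dmatch13: "\<lbrakk>x \<in> A; y \<in> A; a \<in> B\<rbrakk> \<Longrightarrow>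
      l\<^bsub>\<lhd>B\<^esub> a x \<rhd>\<^sub>A y + l\<^bsub>\<rhd>B\<^esub> (r\<^bsub>\<lhd>A\<^esub> x a) y = l\<^bsub>\<rhd>B\<^esub> a x \<rhd>\<^sub>A y + l\<^bsub>\<rhd>B\<^esub> (r\<^bsub>\<rhd>A\<^esub> x a) y"
    and dmatch14: "\<lbrakk>x \<in> A; y \<in> A; a \<in> B\<rbrakk> \<Longrightarrow>
      r\<^bsub>\<lhd>B\<^esub> a x \<rhd>\<^sub>A y + l\<^bsub>\<rhd>B\<^esub> (l\<^bsub>\<lhd>A\<^esub> x a) y = r\<^bsub>\<rhd>B\<^esub> a x \<rhd>\<^sub>A y + l\<^bsub>\<rhd>B\<^esub> (l\<^bsub>\<rhd>A\<^esub> x a) y"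
    and dmatch15: "\<lbrakk>x \<in> A; y \<in> A; a \<in> B\<rbrakk> \<Longrightarrow>
      r\<^bsub>\<rhd>B\<^esub> a (x \<lhd>\<^sub>A y) = r\<^bsub>\<rhd>B\<^esub> a (x \<rhd>\<^sub>A y)"
    and dmatch16: "\<lbrakk>x \<in> A; a \<in> B; b \<in> B\<rbrakk> \<Longrightarrow>
      l\<^bsub>\<lhd>A\<^esub> x a \<rhd>\<^sub>B b + l\<^bsub>\<rhd>A\<^esub> (r\<^bsub>\<lhd>B\<^esub> a x) b = l\<^bsub>\<rhd>A\<^esub> x a \<rhd>\<^sub>B b + l\<^bsub>\<rhd>A\<^esub> (r\<^bsub>\<rhd>B\<^esub> a x) b"
    and dmatch17: "\<lbrakk>x \<in> A; a \<in> B; b \<in> B\<rbrakk> \<Longrightarrow>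
      r\<^bsub>\<lhd>A\<^esub> x a \<rhd>\<^sub>B b + l\<^bsub>\<rhd>A\<^esub> (l\<^bsub>\<lhd>B\<^esub> a x) b = r\<^bsub>\<rhd>A\<^esub> x a \<rhd>\<^sub>B b + l\<^bsub>\<rhd>A\<^esub> (l\<^bsub>\<rhd>B\<^esub> a x) b"
    and dmatch18: "\<lbrakk>x \<in> A; a \<in> B; b \<in> B\<rbrakk> \<Longrightarrow>
      r\<^bsub>\<rhd>A\<^esub> x (a \<lhd>\<^sub>B b) = r\<^bsub>\<rhd>A\<^esub> x (a \<rhd>\<^sub>B b)"

section \<open>Co-dialgebras and bi-dialgebras\<close>

locale codialgebra = vector_space s
  for s :: "'f::field \<Rightarrow> 'a::ab_group_add \<Rightarrow> 'a" +
  fixes cr :: "'a \<Rightarrow> ('a, 'f) tensor2" (\<open>\<delta>\<^sub>\<rhd>\<close>) and cl :: "'a \<Rightarrow> ('a, 'f) tensor2" (\<open>\<delta>\<^sub>\<lhd>\<close>)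
  assumes cr_linear: "Vector_Spaces.linear s tensor2_scale \<delta>\<^sub>\<rhd>"
    and cl_linear: "Vector_Spaces.linear s tensor2_scale \<delta>\<^sub>\<lhd>"
    and cr_tensor: "\<delta>\<^sub>\<rhd> x \<in> tensor2_space s"
    and cl_tensor: "\<delta>\<^sub>\<lhd> x \<in> tensor2_space s"
    and cr_coassoc: "id_tensor_co \<delta>\<^sub>\<rhd> (\<delta>\<^sub>\<rhd> x) = co_tensor_id \<delta>\<^sub>\<rhd> (\<delta>\<^sub>\<rhd> x)"
    and cl_coassoc: "id_tensor_co \<delta>\<^sub>\<lhd> (\<delta>\<^sub>\<lhd> x) = co_tensor_id \<delta>\<^sub>\<lhd> (\<delta>\<^sub>\<lhd> x)"
    and co_left_left: "id_tensor_co \<delta>\<^sub>\<lhd> (\<delta>\<^sub>\<lhd> x) = id_tensor_co \<delta>\<^sub>\<rhd> (\<delta>\<^sub>\<lhd> x)"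
    and co_right_left: "co_tensor_id \<delta>\<^sub>\<rhd> (\<delta>\<^sub>\<lhd> x) = id_tensor_co \<delta>\<^sub>\<lhd> (\<delta>\<^sub>\<rhd> x)"
    and co_left_right: "co_tensor_id \<delta>\<^sub>\<lhd> (\<delta>\<^sub>\<rhd> x) = co_tensor_id \<delta>\<^sub>\<rhd> (\<delta>\<^sub>\<rhd> x)"

locale dialgebra_codialgebra = dialgebra s UNIV dr dl + codialgebra s cr cl
  for s :: "'f::field \<Rightarrow> 'a::ab_group_add \<Rightarrow> 'a"
    and dr :: "'a \<Rightarrow> 'a \<Rightarrow> 'a" (infixl \<open>\<rhd>\<close> 70) and dl :: "'a \<Rightarrow> 'a \<Rightarrow> 'a" (infixl \<open>\<lhd>\<close> 70)
    and cr :: "'a \<Rightarrow> ('a, 'f) tensor2" (\<open>\<delta>\<^sub>\<rhd>\<close>) and cl :: "'a \<Rightarrow> ('a, 'f) tensor2" (\<open>\<delta>\<^sub>\<lhd>\<close>)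
begin

abbreviation star :: "'a \<Rightarrow> 'a \<Rightarrow> 'a" (infixl \<open>\<star>\<close> 70) where
  "x \<star> y \<equiv> x \<rhd> y - x \<lhd> y"

abbreviation costar :: "'a \<Rightarrow> ('a, 'f) tensor2" (\<open>\<delta>\<^sub>\<star>\<close>) where
  "\<delta>\<^sub>\<star> x \<equiv> \<delta>\<^sub>\<rhd> x - \<delta>\<^sub>\<lhd> x"

abbreviation tmap :: "('a \<Rightarrow> 'a) \<Rightarrow> ('a \<Rightarrow> 'a) \<Rightarrow> ('a, 'f) tensor2 \<Rightarrow> ('a, 'f) tensor2"
    (infix \<open>\<otimes>\<close> 75) where
  "f \<otimes> g \<equiv> tensor_map s f g"

abbreviation swap :: "('a, 'f) tensor2 \<Rightarrow> ('a, 'f) tensor2" (\<open>\<tau>\<close>) where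
  "\<tau> \<equiv> tensor_swap"

abbreviation Lr (\<open>L\<^sub>\<rhd>\<close>) where "L\<^sub>\<rhd> \<equiv> L_mult (\<rhd>)"
abbreviation Rr (\<open>R\<^sub>\<rhd>\<close>) where "R\<^sub>\<rhd> \<equiv> R_mult (\<rhd>)"
abbreviation Ll (\<open>L\<^sub>\<lhd>\<close>) where "L\<^sub>\<lhd> \<equiv> L_mult (\<lhd>)"
abbreviation Rl (\<open>R\<^sub>\<lhd>\<close>) where "R\<^sub>\<lhd> \<equiv> R_mult (\<lhd>)"
abbreviation Ls (\<open>L\<^sub>\<star>\<close>) where "L\<^sub>\<star> \<equiv> L_mult (\<star>)"
abbreviation Rs (\<open>R\<^sub>\<star>\<close>) where "R\<^sub>\<star> \<equiv> R_mult (\<star>)"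

end

locale bidialgebra = dialgebra_codialgebra s dr dl cr cl
  for s :: "'f::field \<Rightarrow> 'a::ab_group_add \<Rightarrow> 'a"
    and dr :: "'a \<Rightarrow> 'a \<Rightarrow> 'a" (infixl \<open>\<rhd>\<close> 70) and dl :: "'a \<Rightarrow> 'a \<Rightarrow> 'a" (infixl \<open>\<lhd>\<close> 70)
    and cr :: "'a \<Rightarrow> ('a, 'f) tensor2" (\<open>\<delta>\<^sub>\<rhd>\<close>) and cl :: "'a \<Rightarrow> ('a, 'f) tensor2" (\<open>\<delta>\<^sub>\<lhd>\<close>) +
  assumes bi1: "(id \<otimes> L\<^sub>\<lhd> x) (\<delta>\<^sub>\<lhd> y) = (R\<^sub>\<rhd> y \<otimes> id) (\<delta>\<^sub>\<rhd> x)"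
    and bi2: "(L\<^sub>\<lhd> x \<otimes> id) (\<delta>\<^sub>\<rhd> y) = (id \<otimes> L\<^sub>\<lhd> y) (\<tau> (\<delta>\<^sub>\<rhd> x))"
    and bi3: "(R\<^sub>\<rhd> x \<otimes> id) (\<tau> (\<delta>\<^sub>\<lhd> y)) = (id \<otimes> R\<^sub>\<rhd> y) (\<delta>\<^sub>\<lhd> x)"
    and bi4: "\<delta>\<^sub>\<rhd> (x \<rhd> y) = (id \<otimes> L\<^sub>\<rhd> x) (\<delta>\<^sub>\<rhd> y) - (R\<^sub>\<star> y \<otimes> id) (\<delta>\<^sub>\<star> x)"
    and bi5: "\<delta>\<^sub>\<rhd> (x \<lhd> y) = (id \<otimes> L\<^sub>\<lhd> x) (\<delta>\<^sub>\<star> y) + (R\<^sub>\<lhd> y \<otimes> id) (\<delta>\<^sub>\<rhd> x)"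
    and bi6: "\<delta>\<^sub>\<lhd> (x \<rhd> y) = (id \<otimes> L\<^sub>\<star> x) (\<delta>\<^sub>\<lhd> y) + (R\<^sub>\<rhd> y \<otimes> id) (\<delta>\<^sub>\<lhd> x)"
    and bi7: "\<delta>\<^sub>\<lhd> (x \<lhd> y) = (R\<^sub>\<lhd> y \<otimes> id) (\<delta>\<^sub>\<lhd> x) - (id \<otimes> L\<^sub>\<star> x) (\<delta>\<^sub>\<star> y)"
    and bi8: "(L\<^sub>\<star> x \<otimes> id) (\<delta>\<^sub>\<rhd> y) + (id \<otimes> L\<^sub>\<lhd> y) (\<tau> (\<delta>\<^sub>\<lhd> x)) =
              (R\<^sub>\<star> y \<otimes> id) (\<tau> (\<delta>\<^sub>\<star> x)) + (id \<otimes> R\<^sub>\<lhd> x) (\<delta>\<^sub>\<rhd> y)"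
    and bi9: "(R\<^sub>\<lhd> x \<otimes> id) (\<tau> (\<delta>\<^sub>\<lhd> y)) + (id \<otimes> R\<^sub>\<rhd> y) (\<delta>\<^sub>\<star> x) =
              (L\<^sub>\<star> y \<otimes> id) (\<delta>\<^sub>\<star> x) + (id \<otimes> L\<^sub>\<rhd> x) (\<tau> (\<delta>\<^sub>\<lhd> y))"

section \<open>Adequacy of the encodings\<close>

lemma vector_space_fun_scale: "vector_space s \<Longrightarrow> vector_space (fun_scale s)"
  unfolding vector_space_def by (auto simp: fun_scale_def fun_eq_iff)

lemma linear_field_iff:
  assumes "vector_space (s :: 'f::field \<Rightarrow> 'a::ab_group_add \<Rightarrow> 'a)"
  shows "Vector_Spaces.linear s (*) f \<longleftrightarrow>
    (\<forall>x y. f (x + y) = f x + f y) \<and> (\<forall>c x. f (s c x) = c * f x)"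
proof -
  have "vector_space ((*) :: 'f \<Rightarrow> 'f \<Rightarrow> 'f)" by unfold_locales (auto simp: algebra_simps)
  then show ?thesis using assms
    unfolding Vector_Spaces.linear_def module_hom_def module_hom_axioms_def
    by (auto simp: vector_space_def module_def)
qed

lemma linear_endo_iff:
  assumes "vector_space (s :: 'f::field \<Rightarrow> 'a::ab_group_add \<Rightarrow> 'a)"
  shows "Vector_Spaces.linear s s f \<longleftrightarrow>
    (\<forall>x y. f (x + y) = f x + f y) \<and> (\<forall>c x. f (s c x) = s c (f x))"
  using assms unfolding Vector_Spaces.linear_def module_hom_def module_hom_axioms_def
  by (auto simp: vector_space_def module_def)

lemma in_dual_iff:
  "vector_space s \<Longrightarrow> f \<in> dual_space s \<longleftrightarrow>
    (\<forall>x y. f (x + y) = f x + f y) \<and> (\<forall>c x. f (s c x) = c * f x)"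
  by (simp add: dual_space_def linear_field_iff)

lemma tensor_map_pure:
  assumes "vector_space s" "Vector_Spaces.linear s s f" "Vector_Spaces.linear s s g"
  shows "tensor_map s f g (pure_tensor s x y) = pure_tensor s (f x) (g y)"
  using assms
  by (auto simp: tensor_map_def pure_tensor_def fun_eq_iff in_dual_iff linear_endo_iff)

lemma tensor_swap_pure: "tensor_swap (pure_tensor s x y) = pure_tensor s y x"
  by (auto simp: tensor_swap_def pure_tensor_def fun_eq_iff)

lemma pure_tensor_in: "vector_space s \<Longrightarrow> pure_tensor s x y \<in> tensor2_space s"
  by (auto simp: tensor2_space_def pure_tensor_def bilinear_on_def linear_on_def in_dual_iff
      fun_scale_def algebra_simps)

lemma tensor2_dual:
  assumes "Vector_Spaces.linear s tensor2_scale \<delta>"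
  shows "(\<lambda>x. \<delta> x b c) \<in> dual_space s"
proof -
  interpret Vector_Spaces.linear s tensor2_scale \<delta> by fact
  show ?thesis
    by (simp add: in_dual_iff[OF vs1.vector_space_axioms] add scale fun_scale_def)
qed

lemma id_tensor_co_pure:
  assumes "Vector_Spaces.linear s tensor2_scale \<delta>"
  shows "id_tensor_co \<delta> (pure_tensor s x y) =
    (\<lambda>a b c. (if a \<in> dual_space s then a x else 0) * \<delta> y b c)"
  using tensor2_dual[OF assms] by (auto simp: id_tensor_co_def pure_tensor_def fun_eq_iff)

lemma co_tensor_id_pure:
  assumes "Vector_Spaces.linear s tensor2_scale \<delta>"
  shows "co_tensor_id \<delta> (pure_tensor s x y) =
    (\<lambda>a b c. \<delta> x a b * (if c \<in> dual_space s then c y else 0))"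
  using tensor2_dual[OF assms] by (auto simp: co_tensor_id_def pure_tensor_def fun_eq_iff)

lemma linear_on_sum:
  assumes "vector_space s" "vector_space t" "module.subspace s V" "linear_on V s t f"
    and "finite I" "\<And>i. i \<in> I \<Longrightarrow> g i \<in> V"
  shows "f (\<Sum>i\<in>I. s (c i) (g i)) = (\<Sum>i\<in>I. t (c i) (f (g i)))"
proof -
  interpret S: vector_space s by fact
  interpret T: vector_space t by fact
  have f0: "f 0 = 0" using assms(4) S.subspace_0[OF assms(3)]
    unfolding linear_on_def by (metis S.scale_zero_left T.scale_zero_left)
  show ?thesis using assms(5,6)
  proof (induction I rule: finite_induct)
    case (insert i I)
    have "(\<Sum>i\<in>I. s (c i) (g i)) \<in> V" "s (c i) (g i) \<in> V"
      using insert assms(3) by (auto intro: S.subspace_sum S.subspace_scale)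
    then show ?case using insert assms(4) by (simp add: linear_on_def)
  qed (simp add: f0)
qed

lemma sum_fun_apply: "(\<Sum>i\<in>I. f i) x = (\<Sum>i\<in>I. f i x)"
  by (induction I rule: infinite_finite_induct) auto

context finite_dimensional_vector_space
begin

lemma coordinate_in_dual: "(\<lambda>x. representation Basis x i) \<in> dual_space scale"
  by (simp add: in_dual_iff[OF vector_space_axioms] representation_add representation_scale
      independent_Basis span_Basis)

lemma basis_expansion: "(\<Sum>i\<in>Basis. scale (representation Basis x i) i) = x"
  by (rule sum_representation_eq) (auto simp: independent_Basis span_Basis finite_Basis)

lemma dual_eq_0: "(\<And>a. a \<in> dual_space scale \<Longrightarrow> a x = 0) \<Longrightarrow> x = 0"
  using basis_expansion[of x] coordinate_in_dual by (metis (no_types, lifting) scale_zero_left sum.neutral)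

lemma double_construction_frobenius:
  assumes "double_construction scale drA dlA drB dlB dr dl"
  shows "skew_frobenius_dialgebra (prod_scale scale dual_scale) (UNIV \<times> dual_space scale) dr dl
    double_form"
proof -
  let ?V = "UNIV \<times> dual_space scale"
  have z: "(0 :: 'b \<Rightarrow> 'a) \<in> dual_space scale"
    by (simp add: in_dual_iff[OF vector_space_axioms])
  have "p = 0" if "p \<in> ?V" "\<forall>q\<in>?V. double_form p q = 0" for p
  proof -
    obtain x a where p: "p = (x, a)" and a: "a \<in> dual_space scale" using \<open>p \<in> ?V\<close> by auto
    have q: "a y - b x = 0" if "b \<in> dual_space scale" for y b
      using \<open>\<forall>q\<in>?V. double_form p q = 0\<close> that unfolding p double_form_def by force
    have "a y = 0" for y using q[OF z, of y] by simp
    moreover from this have "x = 0" using q by (intro dual_eq_0) fastforce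
    ultimately show ?thesis by (simp add: p zero_prod_def fun_eq_iff)
  qed
  moreover have "bilinear_on ?V (prod_scale scale dual_scale) ?V (prod_scale scale dual_scale)
      UNIV (*) double_form"
    by (auto simp: bilinear_on_def linear_on_def double_form_def prod_scale_def fun_scale_def
        in_dual_iff[OF vector_space_axioms] algebra_simps)
  ultimately show ?thesis using assms
    unfolding double_construction_def skew_frobenius_dialgebra_def
      skew_frobenius_dialgebra_axioms_def
    by (auto simp: double_form_def)
qed

lemma dual_expansion:
  assumes "a \<in> dual_space scale"
  shows "a = (\<Sum>i\<in>Basis. dual_scale (a i) (\<lambda>x. representation Basis x i))"
proof
  fix x
  have "a x = a (\<Sum>i\<in>Basis. scale (representation Basis x i) i)"
    by (simp add: basis_expansion)
  also have "\<dots> = (\<Sum>i\<in>Basis. representation Basis x i * a i)"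
  proof -
    interpret Vector_Spaces.linear scale "(*)" a using assms by (simp add: dual_space_def)
    show ?thesis by (simp add: sum scale)
  qed
  finally show "a x = (\<Sum>i\<in>Basis. dual_scale (a i) (\<lambda>x. representation Basis x i)) x"
    by (simp add: sum_fun_apply fun_scale_def mult.commute)
qed

lemma linear_on_dual_expansion:
  assumes "linear_on (dual_space scale) dual_scale u F" "vector_space u" "a \<in> dual_space scale"
  shows "F a = (\<Sum>i\<in>Basis. u (a i) (F (\<lambda>x. representation Basis x i)))"
proof -
  have "vector_space ((*) :: 'a \<Rightarrow> 'a \<Rightarrow> 'a)" by unfold_locales (auto simp: algebra_simps)
  then have "vector_space (dual_scale :: 'a \<Rightarrow> ('b \<Rightarrow> 'a) \<Rightarrow> ('b \<Rightarrow> 'a))"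
    by (rule vector_space_fun_scale)
  moreover from this have "module.subspace dual_scale (dual_space scale)"
    by (auto simp: module.subspace_def module_iff_vector_space
        in_dual_iff[OF vector_space_axioms] fun_scale_def algebra_simps)
  ultimately show ?thesis
    using linear_on_sum[OF _ assms(2) _ assms(1) finite_Basis,
        of "\<lambda>i x. representation Basis x i" a]
      dual_expansion[OF assms(3)] coordinate_in_dual by simp
qed

text \<open>The identification of \<open>A\<^sup>*\<^sup>*\<close> with \<open>A\<close> behind \<^const>\<open>codual_rep\<close>.\<close>

lemma bidual_representable:
  assumes F: "linear_on (dual_space scale) dual_scale (*) F"
  shows "\<exists>!y. \<forall>v\<in>dual_space scale. v y = F v"
proof (rule ex_ex1I)
  define y where "y = (\<Sum>i\<in>Basis. scale (F (\<lambda>x. representation Basis x i)) i)"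
  have "v y = F v" if v: "v \<in> dual_space scale" for v
  proof -
    interpret Vector_Spaces.linear scale "(*)" v using v by (simp add: dual_space_def)
    show ?thesis using linear_on_dual_expansion[OF F vs2.vector_space_axioms v]
      by (simp add: y_def sum scale mult.commute)
  qed
  then show "\<exists>y. \<forall>v\<in>dual_space scale. v y = F v" by blast
next
  fix y z assume "\<forall>v\<in>dual_space scale. v y = F v" "\<forall>v\<in>dual_space scale. v z = F v"
  moreover have "v (y - z) = v y - v z" if "v \<in> dual_space scale" for v
  proof -
    interpret Vector_Spaces.linear scale "(*)" v using that by (simp add: dual_space_def)
    show ?thesis by (rule diff)
  qed
  ultimately have "y - z = 0" using dual_eq_0[of "y - z"] by (metis right_minus_eq)
  then show "y = z" by simp
qed

lemma tensor2_expansion: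
  assumes t: "t \<in> tensor2_space scale"
  shows "t = (\<Sum>(i, j)\<in>Basis \<times> Basis. tensor2_scale
    (t (\<lambda>x. representation Basis x i) (\<lambda>x. representation Basis x j)) (pure_tensor scale i j))"
    (is "t = ?r")
proof (intro ext)
  fix a b
  have vs: "vector_space ((*) :: 'a \<Rightarrow> 'a \<Rightarrow> 'a)" by unfold_locales (auto simp: algebra_simps)
  have l: "linear_on (dual_space scale) dual_scale (*) (t a)"
      "linear_on (dual_space scale) dual_scale (*) (\<lambda>a. t a b)"
    if "a \<in> dual_space scale" "b \<in> dual_space scale" for a b
    using t that by (auto simp: tensor2_space_def bilinear_on_def)
  have r: "?r a b = (\<Sum>i\<in>Basis. \<Sum>j\<in>Basis.
      t (\<lambda>x. representation Basis x i) (\<lambda>x. representation Basis x j) * pure_tensor scale i j a b)"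
    by (simp add: sum_fun_apply sum.cartesian_product fun_scale_def case_prod_unfold)
  show "t a b = ?r a b"
  proof (cases "a \<in> dual_space scale \<and> b \<in> dual_space scale")
    case False
    then show ?thesis unfolding r using t by (auto simp: tensor2_space_def pure_tensor_def)
  next
    case True
    then have a: "a \<in> dual_space scale" and b: "b \<in> dual_space scale" by auto
    have "t a b = (\<Sum>i\<in>Basis. a i * t (\<lambda>x. representation Basis x i) b)"
      using linear_on_dual_expansion[OF l(2)[OF a b] vs a] .
    also have "\<dots> = (\<Sum>i\<in>Basis. a i * (\<Sum>j\<in>Basis. b j *
        t (\<lambda>x. representation Basis x i) (\<lambda>x. representation Basis x j)))"
      using linear_on_dual_expansion[OF l(1)[OF coordinate_in_dual b] vs b] by simp
    also have "\<dots> = ?r a b" unfolding r using a b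
      by (simp add: pure_tensor_def sum_distrib_left mult_ac)
    finally show ?thesis .
  qed
qed

lemma linear_on_tensor2_expansion:
  assumes "linear_on (tensor2_space scale) tensor2_scale u F" "vector_space u"
    "t \<in> tensor2_space scale"
  shows "F t = (\<Sum>(i, j)\<in>Basis \<times> Basis. u
    (t (\<lambda>x. representation Basis x i) (\<lambda>x. representation Basis x j)) (F (pure_tensor scale i j)))"
proof -
  have "vector_space ((*) :: 'a \<Rightarrow> 'a \<Rightarrow> 'a)" by unfold_locales (auto simp: algebra_simps)
  then have "vector_space (tensor2_scale :: 'a \<Rightarrow> ('b, 'a) tensor2 \<Rightarrow> ('b, 'a) tensor2)"
    by (intro vector_space_fun_scale)
  moreover from this have "module.subspace tensor2_scale (tensor2_space scale)"
    by (auto simp: module.subspace_def module_iff_vector_space tensor2_space_def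
        bilinear_on_def linear_on_def fun_scale_def algebra_simps)
  ultimately show ?thesis
    using linear_on_sum[OF _ assms(2) _ assms(1), of "Basis \<times> Basis"
        "\<lambda>(i, j). pure_tensor scale i j"
        "\<lambda>(i, j). t (\<lambda>x. representation Basis x i) (\<lambda>x. representation Basis x j)"]
      tensor2_expansion[OF assms(3)] finite_Basis pure_tensor_in[OF vector_space_axioms]
    by (simp add: case_prod_unfold)
qed

theorem tensor2_universal_property:
  fixes u :: "'a \<Rightarrow> 'u::ab_group_add \<Rightarrow> 'u"
  assumes u: "vector_space u" and \<beta>: "bilinear_on UNIV scale UNIV scale UNIV u \<beta>"
  shows tensor2_lift_exists: "\<exists>\<Phi>. linear_on (tensor2_space scale) tensor2_scale u \<Phi> \<and>
      (\<forall>x y. \<Phi> (pure_tensor scale x y) = \<beta> x y)"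
    and tensor2_lift_unique: "\<lbrakk>linear_on (tensor2_space scale) tensor2_scale u \<Phi>;
      linear_on (tensor2_space scale) tensor2_scale u \<Psi>;
      \<forall>x y. \<Phi> (pure_tensor scale x y) = \<Psi> (pure_tensor scale x y);
      t \<in> tensor2_space scale\<rbrakk> \<Longrightarrow> \<Phi> t = \<Psi> t"
proof -
  interpret U: vector_space u by fact
  define \<Phi> where "\<Phi> t = (\<Sum>(i, j)\<in>Basis \<times> Basis. u
    (t (\<lambda>x. representation Basis x i) (\<lambda>x. representation Basis x j)) (\<beta> i j))" for t
  have "linear_on (tensor2_space scale) tensor2_scale u \<Phi>"
    by (simp add: linear_on_def \<Phi>_def fun_scale_def case_prod_unfold U.scale_left_distrib
        sum.distrib U.scale_sum_right)
  moreover have "\<Phi> (pure_tensor scale x y) = \<beta> x y" for x y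
  proof -
    have l: "linear_on UNIV scale u (\<beta> x)" "linear_on UNIV scale u (\<lambda>x. \<beta> x y)" for x y
      using \<beta> by (auto simp: bilinear_on_def)
    have "\<beta> x y = (\<Sum>i\<in>Basis. u (representation Basis x i) (\<beta> i y))"
      using linear_on_sum[OF vector_space_axioms u subspace_UNIV l(2)[of y] finite_Basis,
          of "\<lambda>i. i" "representation Basis x"] by (simp add: basis_expansion)
    also have "\<dots> = (\<Sum>i\<in>Basis. u (representation Basis x i)
        (\<Sum>j\<in>Basis. u (representation Basis y j) (\<beta> i j)))"
      using linear_on_sum[OF vector_space_axioms u subspace_UNIV l(1) finite_Basis,
          where g = "\<lambda>i. i" and c = "representation Basis y"] by (simp add: basis_expansion)
    also have "\<dots> = \<Phi> (pure_tensor scale x y)"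
      by (simp add: \<Phi>_def pure_tensor_def coordinate_in_dual sum.cartesian_product[symmetric]
          U.scale_sum_right)
    finally show ?thesis by simp
  qed
  ultimately show "\<exists>\<Phi>. linear_on (tensor2_space scale) tensor2_scale u \<Phi> \<and>
      (\<forall>x y. \<Phi> (pure_tensor scale x y) = \<beta> x y)" by blast
next
  assume "linear_on (tensor2_space scale) tensor2_scale u \<Phi>"
    "linear_on (tensor2_space scale) tensor2_scale u \<Psi>"
    "\<forall>x y. \<Phi> (pure_tensor scale x y) = \<Psi> (pure_tensor scale x y)"
    "t \<in> tensor2_space scale"
  then show "\<Phi> t = \<Psi> t"
    using linear_on_tensor2_expansion[of u \<Phi> t] linear_on_tensor2_expansion[of u \<Psi> t] u by simp
qed

end

end

theory Submission
  imports Defs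
begin

text \<open>
  Invariance of the form forces the two products on \<open>A \<oplus> A\<^sup>*\<close> to be those of the matched
  product for the coadjoint actions, and conversely the form is invariant for that product.
  The coadjoint actions are always bimodules, so (a) and (b) both reduce to the mixed
  associativity laws, tested by the pairing so that each involves two elements \<open>x, y\<close> of \<open>A\<close>
  and two elements \<open>a, b\<close> of \<open>A\<^sup>*\<close>.  These are linear relations between scalars such as
  \<open>(a \<rhd> b)(x \<rhd> y)\<close> and \<open>(a \<rhd> b(x \<lhd> \<cdot>))(y)\<close>; up to permuting \<open>x, y\<close> and \<open>a, b\<close> they have the
  same span as the nine bi-dialgebra equations evaluated at \<open>a \<otimes> b\<close>.
\<close>

section \<open>The direct sum of a matched pair\<close>

text \<open>With \<open>p = (x, a)\<close> and \<open>q = (y, b)\<close> this is the product of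
  \<open>x + a\<close> and \<open>y + b\<close> in the bicrossed sum of two algebras acting on each
  other. It handles one product at a time, so a dialgebra uses two copies.\<close>

definition matched_product ::
  "('a::ab_group_add \<Rightarrow> 'a \<Rightarrow> 'a) \<Rightarrow> ('b::ab_group_add \<Rightarrow> 'b \<Rightarrow> 'b) \<Rightarrow>
   ('a \<Rightarrow> 'b \<Rightarrow> 'b) \<Rightarrow> ('a \<Rightarrow> 'b \<Rightarrow> 'b) \<Rightarrow> ('b \<Rightarrow> 'a \<Rightarrow> 'a) \<Rightarrow> ('b \<Rightarrow> 'a \<Rightarrow> 'a) \<Rightarrow>
   'a \<times> 'b \<Rightarrow> 'a \<times> 'b \<Rightarrow> 'a \<times> 'b" where
  "matched_product mA mB lA rA lB rB p q =
     (mA (fst p) (fst q) + lB (snd p) (fst q) + rB (snd q) (fst p),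
      mB (snd p) (snd q) + lA (fst p) (snd q) + rA (fst q) (snd p))"

lemma vector_space_prod_scale:
  "vector_space s \<Longrightarrow> vector_space t \<Longrightarrow> vector_space (prod_scale s t)"
  unfolding vector_space_def by (auto simp: prod_scale_def)

lemma subspace_prod_scale:
  assumes "vector_space s" "vector_space t" "module.subspace s V" "module.subspace t W"
  shows "module.subspace (prod_scale s t) (V \<times> W)"
proof -
  interpret S: vector_space s by fact
  interpret T: vector_space t by fact
  interpret P: vector_space "prod_scale s t" using assms(1,2) by (rule vector_space_prod_scale)
  show ?thesis
    using assms(3,4)
    by (auto simp: P.subspace_def S.subspace_def T.subspace_def prod_scale_def zero_prod_def)
qed

lemma bilinear_on_matched_product:
  assumes "vector_space s" "vector_space t" "module.subspace s A" "module.subspace t B"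
    and "bilinear_on A s A s A s mA" "bilinear_on B t B t B t mB"
    and "bilinear_on A s B t B t lA" "bilinear_on A s B t B t rA"
    and "bilinear_on B t A s A s lB" "bilinear_on B t A s A s rB"
  shows "bilinear_on (A \<times> B) (prod_scale s t) (A \<times> B) (prod_scale s t) (A \<times> B) (prod_scale s t)
    (matched_product mA mB lA rA lB rB)"
proof -
  interpret S: vector_space s by fact
  interpret T: vector_space t by fact
  note add = S.subspace_add[OF assms(3)] T.subspace_add[OF assms(4)]
  show ?thesis
    using assms(5-)
    by (auto simp: bilinear_on_def linear_on_def matched_product_def prod_scale_def add
        S.scale_right_distrib T.scale_right_distrib algebra_simps)
qed

section \<open>Homogeneous elements and extension by additivity\<close>

lemma bilinear_on_zero:
  assumes "vector_space s" "vector_space t" "vector_space u"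
    and "module.subspace s V" "module.subspace t W" "bilinear_on V s W t U u m"
  shows "y \<in> W \<Longrightarrow> m 0 y = 0" "x \<in> V \<Longrightarrow> m x 0 = 0"
proof -
  interpret S: vector_space s by fact
  interpret T: vector_space t by fact
  interpret U: vector_space u by fact
  note zero = S.subspace_0[OF assms(4)] T.subspace_0[OF assms(5)]
  show "m 0 y = 0" if "y \<in> W"
    using assms(6) that zero unfolding bilinear_on_def linear_on_def
    by (metis S.scale_zero_left U.scale_zero_left)
  show "m x 0 = 0" if "x \<in> V"
    using assms(6) that zero unfolding bilinear_on_def linear_on_def
    by (metis T.scale_zero_left U.scale_zero_left)
qed

text \<open>Both sides are additive in each argument, so the identity spreads from \<open>S\<close>
  to \<open>V\<close>. Four independent products let one lemma serve associativity and the laws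
  linking two products.\<close>

lemma mixed_assoc_from_generators:
  assumes m: "bilinear_on V s V s V s m1" "bilinear_on V s V s V s m2"
      "bilinear_on V s V s V s m3" "bilinear_on V s V s V s m4"
    and S: "S \<subseteq> V" "\<And>x. x \<in> V \<Longrightarrow> \<exists>u\<in>S. \<exists>v\<in>S. x = u + v"
    and xyz: "x \<in> V" "y \<in> V" "z \<in> V"
    and gen: "\<And>x y z. x \<in> S \<Longrightarrow> y \<in> S \<Longrightarrow> z \<in> S \<Longrightarrow> m2 (m1 x y) z = m3 x (m4 y z)"
  shows "m2 (m1 x y) z = m3 x (m4 y z)"
proof -
  have closed: "m u v \<in> V" if "m \<in> {m1, m4}" "u \<in> V" "v \<in> V" for m u v
    using m that unfolding bilinear_on_def by blast
  have add: "m (u + v) w = m u w + m v w" "m w (u + v) = m w u + m w v"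
    if "m \<in> {m1, m2, m3, m4}" "u \<in> V" "v \<in> V" "w \<in> V" for m u v w
    using m that unfolding bilinear_on_def linear_on_def by auto
  \<comment> \<open>The arguments leave \<open>S\<close> one at a time, starting with the
    last.\<close>
  have 1: "m2 (m1 u v) w = m3 u (m4 v w)" if "u \<in> S" "v \<in> S" "w \<in> V" for u v w
    using S(2)[OF that(3)] that(1,2) S(1) by (auto simp: add closed gen subset_iff)
  have 2: "m2 (m1 u v) w = m3 u (m4 v w)" if "u \<in> S" "v \<in> V" "w \<in> V" for u v w
    using S(2)[OF that(2)] that S(1) by (auto simp: add closed 1 subset_iff)
  show ?thesis
    using S(2)[OF xyz(1)] xyz S(1) by (auto simp: add closed 2 subset_iff)
qed

section \<open>Matched pairs give algebras and dialgebras on the direct sum\<close>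

context assoc_matched_pair
begin

abbreviation sum_mult :: "'a \<times> 'b \<Rightarrow> 'a \<times> 'b \<Rightarrow> 'a \<times> 'b" where
  "sum_mult \<equiv> matched_product multA multB lA rA lB rB"

lemmas component_bilinear =
  ModB.Alg.mult_bilinear ModA.Alg.mult_bilinear
  ModB.l_linear ModB.r_linear ModA.l_linear ModA.r_linear

lemmas spaces = ModB.Alg.vector_space_axioms ModB.Mod.vector_space_axioms
  ModB.Alg.carrier_subspace ModA.Alg.carrier_subspace

lemma sum_mult_bilinear:
  "bilinear_on (A \<times> B) (prod_scale sA sB) (A \<times> B) (prod_scale sA sB) (A \<times> B) (prod_scale sA sB)
     sum_mult"
  by (intro bilinear_on_matched_product spaces component_bilinear)

lemma component_closed:
  "x \<in> A \<Longrightarrow> y \<in> A \<Longrightarrow> x \<cdot>\<^sub>A y \<in> A" "a \<in> B \<Longrightarrow> b \<in> B \<Longrightarrow> a \<cdot>\<^sub>B b \<in> B"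
  "x \<in> A \<Longrightarrow> b \<in> B \<Longrightarrow> lA x b \<in> B" "x \<in> A \<Longrightarrow> b \<in> B \<Longrightarrow> rA x b \<in> B"
  "b \<in> B \<Longrightarrow> x \<in> A \<Longrightarrow> lB b x \<in> A" "b \<in> B \<Longrightarrow> x \<in> A \<Longrightarrow> rB b x \<in> A"
  using component_bilinear by (simp_all add: bilinear_on_def)

lemma carrier_zero: "0 \<in> A" "0 \<in> B"
  using spaces(3,4) ModB.Alg.subspace_0 ModB.Mod.subspace_0 by blast+

lemmas component_zero =
  bilinear_on_zero[OF spaces(1,1,1,3,3) component_bilinear(1)]
  bilinear_on_zero[OF spaces(2,2,2,4,4) component_bilinear(2)]
  bilinear_on_zero[OF spaces(1,2,2,3,4) component_bilinear(3)]
  bilinear_on_zero[OF spaces(1,2,2,3,4) component_bilinear(4)]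
  bilinear_on_zero[OF spaces(2,1,1,4,3) component_bilinear(5)]
  bilinear_on_zero[OF spaces(2,1,1,4,3) component_bilinear(6)]

lemma homogeneous_generators:
  defines "S \<equiv> A \<times> {0} \<union> {0} \<times> B"
  shows "S \<subseteq> A \<times> B" and "\<And>p. p \<in> A \<times> B \<Longrightarrow> \<exists>u\<in>S. \<exists>v\<in>S. p = u + v"
proof -
  show "S \<subseteq> A \<times> B" using carrier_zero by (auto simp: S_def)
  show "\<exists>u\<in>S. \<exists>v\<in>S. p = u + v" if "p \<in> A \<times> B" for p
    unfolding S_def
    by (rule bexI[of _ "(fst p, 0)"], rule bexI[of _ "(0, snd p)"]) (use that in auto)
qed

text \<open>The summands are put in the order in which they occur in \<^const>\<open>matched_product\<close>, so
  that the equations can serve as rewrite rules.\<close>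

lemmas match_rules =
  match1[THEN trans, OF _ _ _ add.commute]
  match2[THEN trans, OF _ _ _ add.commute]
  match3[THEN trans, OF _ _ _ add.commute]
  match4[THEN trans, OF _ _ _ add.commute]
  add.commute[THEN trans, OF match5[THEN trans, OF _ _ _ add.commute]]
  add.commute[THEN trans, OF match6[THEN trans, OF _ _ _ add.commute]]

text \<open>Homogeneous triples suffice. In each of the six mixed patterns, the component in the
  summand contributing a single factor is a bimodule law, and the other component is one of
  \<open>match1\<close> to \<open>match6\<close>.\<close>

lemma assoc_algebra_sum: "assoc_algebra (prod_scale sA sB) (A \<times> B) sum_mult"
proof -
  have "sum_mult (sum_mult p q) r = sum_mult p (sum_mult q r)"
    if "p \<in> A \<times> B" "q \<in> A \<times> B" "r \<in> A \<times> B" for p q r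
    using sum_mult_bilinear sum_mult_bilinear sum_mult_bilinear sum_mult_bilinear
      homogeneous_generators that
    by (rule mixed_assoc_from_generators)
      (auto simp: matched_product_def component_closed component_zero carrier_zero match_rules
        ModB.Alg.mult_assoc ModA.Alg.mult_assoc ModB.l_mult ModB.r_mult ModB.l_r_commute
        ModA.l_mult ModA.r_mult ModA.l_r_commute)
  then show ?thesis
    using vector_space_prod_scale[OF spaces(1,2)] subspace_prod_scale[OF spaces] sum_mult_bilinear
    by (simp add: assoc_algebra_def assoc_algebra_axioms_def)
qed

end

lemma (in dialgebra_matched_pair) dialgebra_sum:
  "dialgebra (prod_scale sA sB) (A \<times> B) R.sum_mult L.sum_mult"
proof -
  note eval = matched_product_def R.component_closed R.component_zero R.carrier_zero
    L.component_closed L.component_zero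
  note bilinear = R.sum_mult_bilinear L.sum_mult_bilinear
  \<comment> \<open>\<open>dmatch1\<close> to \<open>dmatch6\<close> equate
    \<open>p \<lhd> (q \<lhd> r)\<close> with \<open>p \<lhd> (q \<rhd> r)\<close>, so they are
    combined with the matching laws of \<open>\<lhd>\<close>. Chaining by \<open>trans\<close> makes
    \<open>dmatch3\<close> and \<open>dmatch6\<close> rewrite straight to the expanded form.\<close>
  have "L.sum_mult (L.sum_mult p q) r = L.sum_mult p (R.sum_mult q r)"
    if "p \<in> A \<times> B" "q \<in> A \<times> B" "r \<in> A \<times> B" for p q r
    using bilinear(2,2,2,1) R.homogeneous_generators that
    by (rule mixed_assoc_from_generators)
      (auto simp: eval L.match_rules dmatch1 dmatch2 dmatch4 dmatch5
        dmatch3[symmetric, THEN trans, OF _ _ _ L.match_rules(1)]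
        dmatch6[symmetric, THEN trans, OF _ _ _ L.match_rules(3)]
        ModB.Alg.left_left ModA.Alg.left_left
        ModB.L.l_mult ModB.L.l_r_commute[symmetric] ModB.bimod2 ModB.bimod3
        ModB.bimod1[symmetric, THEN trans, OF _ _ _ ModB.L.r_mult]
        ModA.L.l_mult ModA.L.l_r_commute[symmetric] ModA.bimod2 ModA.bimod3
        ModA.bimod1[symmetric, THEN trans, OF _ _ _ ModA.L.r_mult])
  moreover have "L.sum_mult (R.sum_mult p q) r = R.sum_mult p (L.sum_mult q r)"
    if "p \<in> A \<times> B" "q \<in> A \<times> B" "r \<in> A \<times> B" for p q r
    using bilinear(1,2,1,2) R.homogeneous_generators that
    by (rule mixed_assoc_from_generators)
      (auto simp: eval dmatch7 dmatch8 dmatch9 dmatch10 dmatch11 dmatch12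
        ModB.Alg.right_left ModA.Alg.right_left
        ModB.bimod4 ModB.bimod5 ModB.bimod6 ModA.bimod4 ModA.bimod5 ModA.bimod6)
  \<comment> \<open>\<open>dmatch13\<close> to \<open>dmatch18\<close> equate
    \<open>(p \<lhd> q) \<rhd> r\<close> with \<open>(p \<rhd> q) \<rhd> r\<close>; the matching
    laws of \<open>\<rhd>\<close> then move the brackets.\<close>
  moreover have "R.sum_mult (L.sum_mult p q) r = R.sum_mult p (R.sum_mult q r)"
    if "p \<in> A \<times> B" "q \<in> A \<times> B" "r \<in> A \<times> B" for p q r
    using bilinear(2,1,1,1) R.homogeneous_generators that
    by (rule mixed_assoc_from_generators)
      (auto simp: eval R.match_rules dmatch13 dmatch14 dmatch15 dmatch16 dmatch17 dmatch18
        ModB.Alg.left_right ModA.Alg.left_right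
        ModB.R.l_mult ModB.R.r_mult ModB.R.l_r_commute ModB.bimod7 ModB.bimod8 ModB.bimod9
        ModA.R.l_mult ModA.R.r_mult ModA.R.l_r_commute ModA.bimod7 ModA.bimod8 ModA.bimod9)
  ultimately show ?thesis
    using R.assoc_algebra_sum L.assoc_algebra_sum
    by (simp add: dialgebra_def dialgebra_axioms_def)
qed

section \<open>Coadjoint actions\<close>

text \<open>Both sides equal \<open>(x \<lhd> y) \<lhd> z\<close>. Together with
  \<open>R.mult_assoc\<close>, \<open>left_left\<close>, \<open>right_left\<close> and
  \<open>left_right\<close> this rewrites the eight triple products to three normal forms:
  \<open>x \<rhd> (y \<rhd> z)\<close>, \<open>x \<rhd> (y \<lhd> z)\<close> and
  \<open>x \<lhd> (y \<rhd> z)\<close>.\<close>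

lemma (in dialgebra) left_nested:
  "\<lbrakk>x \<in> V; y \<in> V; z \<in> V\<rbrakk> \<Longrightarrow> x \<lhd> (y \<lhd> z) = x \<lhd> (y \<rhd> z)"
  using L.mult_assoc left_left by metis

locale dual_dialgebras =
  finite_dimensional_vector_space s Basis +
  A: dialgebra s UNIV drA dlA +
  B: dialgebra dual_scale "dual_space s" drB dlB
  for s :: "'f::field \<Rightarrow> 'a::ab_group_add \<Rightarrow> 'a" and Basis :: "'a set"
    and drA :: "'a \<Rightarrow> 'a \<Rightarrow> 'a" (infixl \<open>\<rhd>\<close> 70) and dlA :: "'a \<Rightarrow> 'a \<Rightarrow> 'a" (infixl \<open>\<lhd>\<close> 70)
    and drB :: "('a \<Rightarrow> 'f) \<Rightarrow> ('a \<Rightarrow> 'f) \<Rightarrow> ('a \<Rightarrow> 'f)" (infixl \<open>\<rhd>\<^sub>*\<close> 70)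
    and dlB :: "('a \<Rightarrow> 'f) \<Rightarrow> ('a \<Rightarrow> 'f) \<Rightarrow> ('a \<Rightarrow> 'f)" (infixl \<open>\<lhd>\<^sub>*\<close> 70)
begin

abbreviation "D \<equiv> dual_space s"

abbreviation Lr (\<open>L\<^sub>\<rhd>\<close>) where "L\<^sub>\<rhd> \<equiv> L_mult (\<rhd>)"
abbreviation Rr (\<open>R\<^sub>\<rhd>\<close>) where "R\<^sub>\<rhd> \<equiv> R_mult (\<rhd>)"
abbreviation Ll (\<open>L\<^sub>\<lhd>\<close>) where "L\<^sub>\<lhd> \<equiv> L_mult (\<lhd>)"
abbreviation Rl (\<open>R\<^sub>\<lhd>\<close>) where "R\<^sub>\<lhd> \<equiv> R_mult (\<lhd>)"

text \<open>The first letter is the side of the action, the second the product (\<open>r\<close> for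
  \<open>\<rhd>\<close>, \<open>l\<close> for \<open>\<lhd>\<close>), the capital the acting
  algebra.\<close>

abbreviation "lrA \<equiv> - dual_rep R\<^sub>\<lhd>"
abbreviation "rrA \<equiv> dual_rep L\<^sub>\<lhd> - dual_rep L\<^sub>\<rhd>"
abbreviation "llA \<equiv> dual_rep R\<^sub>\<rhd> - dual_rep R\<^sub>\<lhd>"
abbreviation "rlA \<equiv> - dual_rep L\<^sub>\<rhd>"
abbreviation "lrB \<equiv> - codual_rep s (R_mult (\<lhd>\<^sub>*))"
abbreviation "rrB \<equiv> codual_rep s (L_mult (\<lhd>\<^sub>*)) - codual_rep s (L_mult (\<rhd>\<^sub>*))"
abbreviation "llB \<equiv> codual_rep s (R_mult (\<rhd>\<^sub>*)) - codual_rep s (R_mult (\<lhd>\<^sub>*))"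
abbreviation "rlB \<equiv> - codual_rep s (L_mult (\<rhd>\<^sub>*))"

section \<open>Calculus of the pairing between the space and its dual\<close>

lemma dual_linear:
  assumes "a \<in> D"
  shows "a (x + y) = a x + a y" "a (x - y) = a x - a y" "a (- x) = - a x" "a (s c x) = c * a x"
    "a 0 = 0"
proof -
  interpret Vector_Spaces.linear s "(*)" a using assms by (simp add: dual_space_def)
  show "a (x + y) = a x + a y" "a (x - y) = a x - a y" "a (- x) = - a x" "a (s c x) = c * a x"
    "a 0 = 0"
    by (rule add diff neg scale zero)+
qed

lemma dual_closed:
  "a \<in> D \<Longrightarrow> b \<in> D \<Longrightarrow> a + b \<in> D" "a \<in> D \<Longrightarrow> b \<in> D \<Longrightarrow> a - b \<in> D" "a \<in> D \<Longrightarrow> - a \<in> D"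
  "a \<in> D \<Longrightarrow> dual_scale c a \<in> D" "0 \<in> D"
  by (auto simp: in_dual_iff[OF vector_space_axioms] fun_scale_def algebra_simps)

text \<open>Does for equations in the space what \<open>fun_eq_iff\<close> does for functionals: it
  turns them into scalar equations.\<close>

lemma dual_separates: "x = y \<longleftrightarrow> (\<forall>v\<in>D. v x = v y)"
  using dual_eq_0[of "x - y"] by (auto simp: dual_linear)

lemma mult_linear:
  "(x + y) \<rhd> z = x \<rhd> z + y \<rhd> z" "z \<rhd> (x + y) = z \<rhd> x + z \<rhd> y"
  "s c x \<rhd> z = s c (x \<rhd> z)" "z \<rhd> s c x = s c (z \<rhd> x)"
  "(x + y) \<lhd> z = x \<lhd> z + y \<lhd> z" "z \<lhd> (x + y) = z \<lhd> x + z \<lhd> y"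
  "s c x \<lhd> z = s c (x \<lhd> z)" "z \<lhd> s c x = s c (z \<lhd> x)"
  using A.R.mult_bilinear A.L.mult_bilinear by (auto simp: bilinear_on_def linear_on_def)

lemma mult_minus:
  "(- x) \<rhd> z = - (x \<rhd> z)" "z \<rhd> (- x) = - (z \<rhd> x)" "(- x) \<lhd> z = - (x \<lhd> z)" "z \<lhd> (- x) = - (z \<lhd> x)"
  using mult_linear(3,4,7,8)[where c = "- 1"] by simp_all

lemma mult_diff:
  "(x - y) \<rhd> z = x \<rhd> z - y \<rhd> z" "z \<rhd> (x - y) = z \<rhd> x - z \<rhd> y"
  "(x - y) \<lhd> z = x \<lhd> z - y \<lhd> z" "z \<lhd> (x - y) = z \<lhd> x - z \<lhd> y"
  using mult_linear(1,2,5,6)[where y = "- y"] by (simp_all add: mult_minus)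

lemma dual_mult_closed: "a \<in> D \<Longrightarrow> b \<in> D \<Longrightarrow> a \<rhd>\<^sub>* b \<in> D" "a \<in> D \<Longrightarrow> b \<in> D \<Longrightarrow> a \<lhd>\<^sub>* b \<in> D"
  using B.R.mult_bilinear B.L.mult_bilinear by (simp_all add: bilinear_on_def)

lemma dual_mult_linear:
  assumes "a \<in> D" "b \<in> D" "c \<in> D"
  shows "(a + b) \<rhd>\<^sub>* c = a \<rhd>\<^sub>* c + b \<rhd>\<^sub>* c" "c \<rhd>\<^sub>* (a + b) = c \<rhd>\<^sub>* a + c \<rhd>\<^sub>* b"
    "dual_scale k a \<rhd>\<^sub>* c = dual_scale k (a \<rhd>\<^sub>* c)"
    "c \<rhd>\<^sub>* dual_scale k a = dual_scale k (c \<rhd>\<^sub>* a)"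
    "(a + b) \<lhd>\<^sub>* c = a \<lhd>\<^sub>* c + b \<lhd>\<^sub>* c" "c \<lhd>\<^sub>* (a + b) = c \<lhd>\<^sub>* a + c \<lhd>\<^sub>* b"
    "dual_scale k a \<lhd>\<^sub>* c = dual_scale k (a \<lhd>\<^sub>* c)"
    "c \<lhd>\<^sub>* dual_scale k a = dual_scale k (c \<lhd>\<^sub>* a)"
  using B.R.mult_bilinear B.L.mult_bilinear assms by (simp_all add: bilinear_on_def linear_on_def)

lemma fun_scale_apply: "fun_scale t c f i = t c (f i)"
  by (simp add: fun_scale_def)

lemma dual_scale_minus_one: "dual_scale (- 1) a = - a" for a :: "'a \<Rightarrow> 'f"
  by (simp add: fun_scale_def fun_eq_iff)

lemma dual_mult_minus:
  assumes "a \<in> D" "c \<in> D"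
  shows "(- a) \<rhd>\<^sub>* c = - (a \<rhd>\<^sub>* c)" "c \<rhd>\<^sub>* (- a) = - (c \<rhd>\<^sub>* a)"
    "(- a) \<lhd>\<^sub>* c = - (a \<lhd>\<^sub>* c)" "c \<lhd>\<^sub>* (- a) = - (c \<lhd>\<^sub>* a)"
  using dual_mult_linear(3,4,7,8)[OF assms(1) assms(1) assms(2), where k = "- 1"]
  by (simp_all add: dual_scale_minus_one)

lemma dual_mult_diff:
  assumes "a \<in> D" "b \<in> D" "c \<in> D"
  shows "(a - b) \<rhd>\<^sub>* c = a \<rhd>\<^sub>* c - b \<rhd>\<^sub>* c" "c \<rhd>\<^sub>* (a - b) = c \<rhd>\<^sub>* a - c \<rhd>\<^sub>* b"
    "(a - b) \<lhd>\<^sub>* c = a \<lhd>\<^sub>* c - b \<lhd>\<^sub>* c" "c \<lhd>\<^sub>* (a - b) = c \<lhd>\<^sub>* a - c \<lhd>\<^sub>* b"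
  using dual_mult_linear(1,2,5,6)[OF assms(1) dual_closed(3)[OF assms(2)] assms(3)] assms
  by (simp_all add: dual_mult_minus)

lemma comp_mult_dual:
  assumes "a \<in> D"
  shows "a \<circ> L\<^sub>\<rhd> x \<in> D" "a \<circ> R\<^sub>\<rhd> x \<in> D" "a \<circ> L\<^sub>\<lhd> x \<in> D" "a \<circ> R\<^sub>\<lhd> x \<in> D"
  using assms
  by (auto simp: in_dual_iff[OF vector_space_axioms] L_mult_def R_mult_def mult_linear)

lemma mult_zero: "0 \<rhd> x = 0" "x \<rhd> 0 = 0" "0 \<lhd> x = 0" "x \<lhd> 0 = 0"
  using mult_diff[where x = 0 and y = 0] by simp_all

lemma dual_mult_zero:
  assumes "a \<in> D"
  shows "0 \<rhd>\<^sub>* a = 0" "a \<rhd>\<^sub>* 0 = 0" "0 \<lhd>\<^sub>* a = 0" "a \<lhd>\<^sub>* 0 = 0"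
  using dual_mult_diff[OF assms assms assms] by simp_all

lemma comp_mult_zero:
  "0 \<circ> f = (0 :: 'a \<Rightarrow> 'f)"
  "a \<in> D \<Longrightarrow> a \<circ> L\<^sub>\<rhd> 0 = 0" "a \<in> D \<Longrightarrow> a \<circ> R\<^sub>\<rhd> 0 = 0" "a \<in> D \<Longrightarrow> a \<circ> L\<^sub>\<lhd> 0 = 0" "a \<in> D \<Longrightarrow> a \<circ> R\<^sub>\<lhd> 0 = 0"
  by (simp_all add: fun_eq_iff L_mult_def R_mult_def mult_zero dual_linear)

lemma dual_rep_comp: "dual_rep \<phi> x a = - (a \<circ> \<phi> x)" for a :: "'a \<Rightarrow> 'f"
  by (simp add: dual_rep_def fun_eq_iff)

text \<open>The value functional is linear in \<open>v\<close>, so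
  \<open>bidual_representable\<close> makes the definite description in \<open>codual_rep\<close>
  well defined.\<close>

lemma codual_rep_eval:
  assumes "a \<in> D" "v \<in> D"
  shows "v (codual_rep s (L_mult (\<rhd>\<^sub>*)) a x) = - (a \<rhd>\<^sub>* v) x"
    "v (codual_rep s (R_mult (\<rhd>\<^sub>*)) a x) = - (v \<rhd>\<^sub>* a) x"
    "v (codual_rep s (L_mult (\<lhd>\<^sub>*)) a x) = - (a \<lhd>\<^sub>* v) x"
    "v (codual_rep s (R_mult (\<lhd>\<^sub>*)) a x) = - (v \<lhd>\<^sub>* a) x"
proof -
  have *: "v (codual_rep s \<phi> a x) = - \<phi> a v x"
    if "linear_on D dual_scale (*) (\<lambda>v. - \<phi> a v x)" for \<phi>
    using theI'[OF bidual_representable[OF that]] assms(2) unfolding codual_rep_def by blast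
  show "v (codual_rep s (L_mult (\<rhd>\<^sub>*)) a x) = - (a \<rhd>\<^sub>* v) x"
    "v (codual_rep s (R_mult (\<rhd>\<^sub>*)) a x) = - (v \<rhd>\<^sub>* a) x"
    "v (codual_rep s (L_mult (\<lhd>\<^sub>*)) a x) = - (a \<lhd>\<^sub>* v) x"
    "v (codual_rep s (R_mult (\<lhd>\<^sub>*)) a x) = - (v \<lhd>\<^sub>* a) x"
    using assms(1)
    by (subst *; simp add: linear_on_def L_mult_def R_mult_def dual_mult_linear fun_scale_apply)+
qed

text \<open>An outer multiplication is transposed onto \<open>v\<close>, which stays in
  \<open>D\<close>; then the action is evaluated as before.\<close>

lemma codual_rep_eval_mult:
  assumes a: "a \<in> D" and v: "v \<in> D"
    and "\<phi> \<in> {L_mult (\<rhd>\<^sub>*), R_mult (\<rhd>\<^sub>*), L_mult (\<lhd>\<^sub>*), R_mult (\<lhd>\<^sub>*)}"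
  shows "v (y \<rhd> codual_rep s \<phi> a x) = - \<phi> a (v \<circ> L\<^sub>\<rhd> y) x"
    "v (codual_rep s \<phi> a x \<rhd> y) = - \<phi> a (v \<circ> R\<^sub>\<rhd> y) x"
    "v (y \<lhd> codual_rep s \<phi> a x) = - \<phi> a (v \<circ> L\<^sub>\<lhd> y) x"
    "v (codual_rep s \<phi> a x \<lhd> y) = - \<phi> a (v \<circ> R\<^sub>\<lhd> y) x"
proof -
  have *: "w (codual_rep s \<phi> a x) = - \<phi> a w x" if "w \<in> D" for w
    using assms(3) codual_rep_eval[OF a that, of x] by (auto simp: L_mult_def R_mult_def)
  show "v (y \<rhd> codual_rep s \<phi> a x) = - \<phi> a (v \<circ> L\<^sub>\<rhd> y) x"
    "v (codual_rep s \<phi> a x \<rhd> y) = - \<phi> a (v \<circ> R\<^sub>\<rhd> y) x"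
    "v (y \<lhd> codual_rep s \<phi> a x) = - \<phi> a (v \<circ> L\<^sub>\<lhd> y) x"
    "v (codual_rep s \<phi> a x \<lhd> y) = - \<phi> a (v \<circ> R\<^sub>\<lhd> y) x"
    using comp_mult_dual[OF v, THEN *] by (simp_all add: L_mult_def R_mult_def)
qed

lemmas codual_rep_eval_mults =
  codual_rep_eval_mult[where \<phi> = "L_mult (\<rhd>\<^sub>*)",
    simplified L_mult_def R_mult_def insert_iff simp_thms]
  codual_rep_eval_mult[where \<phi> = "R_mult (\<rhd>\<^sub>*)",
    simplified L_mult_def R_mult_def insert_iff simp_thms]
  codual_rep_eval_mult[where \<phi> = "L_mult (\<lhd>\<^sub>*)",
    simplified L_mult_def R_mult_def insert_iff simp_thms]
  codual_rep_eval_mult[where \<phi> = "R_mult (\<lhd>\<^sub>*)",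
    simplified L_mult_def R_mult_def insert_iff simp_thms]

text \<open>Transposes every action onto functionals, leaving linear combinations of scalars such as
  \<open>(a \<rhd>\<^sub>* b) (x \<rhd> y)\<close> and
  \<open>(a \<rhd>\<^sub>* (b \<circ> L\<^sub>\<rhd> x)) y\<close>. What remains is linear algebra
  in these atoms.\<close>

lemmas pairing_simps = L_mult_def R_mult_def fun_scale_apply dual_rep_comp
  codual_rep_eval codual_rep_eval_mults comp_mult_dual
  dual_mult_closed dual_closed dual_linear mult_linear mult_minus mult_diff mult_zero
  dual_mult_linear dual_mult_minus dual_mult_diff dual_mult_zero comp_mult_zero

text \<open>After transposition each law is a functional applied to an identity between triple
  products, which the normal forms decide.\<close>

lemma coadjoint_bimodule:
  "dialgebra_bimodule s UNIV (\<rhd>) (\<lhd>) dual_scale D lrA rrA llA rlA"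
proof -
  have subspace: "module.subspace dual_scale D" by (rule B.R.carrier_subspace)
  note laws = A.R.mult_assoc A.left_left A.right_left A.left_right A.left_nested
  show ?thesis
    by (intro dialgebra_bimodule.intro assoc_bimodule.intro dialgebra_bimodule_axioms.intro
        assoc_bimodule_axioms.intro A.dialgebra_axioms A.R.assoc_algebra_axioms
        A.L.assoc_algebra_axioms B.R.vector_space_axioms subspace)
      (auto simp: bilinear_on_def linear_on_def fun_eq_iff pairing_simps laws algebra_simps)
qed

text \<open>The same argument with the roles exchanged: the equations lie in the space and are
  tested by functionals.\<close>

lemma coadjoint_dual_bimodule:
  "dialgebra_bimodule dual_scale D (\<rhd>\<^sub>*) (\<lhd>\<^sub>*) s UNIV lrB rrB llB rlB"
proof -
  note laws = B.R.mult_assoc B.left_left B.right_left B.left_right B.left_nested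
  show ?thesis
    by (intro dialgebra_bimodule.intro assoc_bimodule.intro dialgebra_bimodule_axioms.intro
        assoc_bimodule_axioms.intro B.dialgebra_axioms B.R.assoc_algebra_axioms
        B.L.assoc_algebra_axioms vector_space_axioms subspace_UNIV)
      (auto simp: bilinear_on_def linear_on_def dual_separates pairing_simps laws algebra_simps)
qed

end

section \<open>From nine scalar equations to the matched pair\<close>

text \<open>These are the equations \<open>bi1\<close>, ..., \<open>bi9\<close> of a bi-dialgebra, evaluated at \<open>a \<otimes> b\<close>.\<close>

locale compatible_dual_dialgebras = dual_dialgebras +
  assumes compat1: "\<lbrakk>a \<in> D; b \<in> D\<rbrakk> \<Longrightarrow> (a \<lhd>\<^sub>* (b \<circ> L\<^sub>\<lhd> x)) y = ((a \<circ> R\<^sub>\<rhd> y) \<rhd>\<^sub>* b) x"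
    and compat2: "\<lbrakk>a \<in> D; b \<in> D\<rbrakk> \<Longrightarrow> ((a \<circ> L\<^sub>\<lhd> x) \<rhd>\<^sub>* b) y = ((b \<circ> L\<^sub>\<lhd> y) \<rhd>\<^sub>* a) x"
    and compat3: "\<lbrakk>a \<in> D; b \<in> D\<rbrakk> \<Longrightarrow> (b \<lhd>\<^sub>* (a \<circ> R\<^sub>\<rhd> x)) y = (a \<lhd>\<^sub>* (b \<circ> R\<^sub>\<rhd> y)) x"
    and compat4: "\<lbrakk>a \<in> D; b \<in> D\<rbrakk> \<Longrightarrow> (a \<rhd>\<^sub>* b) (x \<rhd> y) = (a \<rhd>\<^sub>* (b \<circ> L\<^sub>\<rhd> x)) y
      - (((a \<circ> R\<^sub>\<rhd> y) \<rhd>\<^sub>* b) x - ((a \<circ> R\<^sub>\<lhd> y) \<rhd>\<^sub>* b) x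
         - (((a \<circ> R\<^sub>\<rhd> y) \<lhd>\<^sub>* b) x - ((a \<circ> R\<^sub>\<lhd> y) \<lhd>\<^sub>* b) x))"
    and compat5: "\<lbrakk>a \<in> D; b \<in> D\<rbrakk> \<Longrightarrow> (a \<rhd>\<^sub>* b) (x \<lhd> y) =
      (a \<rhd>\<^sub>* (b \<circ> L\<^sub>\<lhd> x)) y - (a \<lhd>\<^sub>* (b \<circ> L\<^sub>\<lhd> x)) y + ((a \<circ> R\<^sub>\<lhd> y) \<rhd>\<^sub>* b) x"
    and compat6: "\<lbrakk>a \<in> D; b \<in> D\<rbrakk> \<Longrightarrow> (a \<lhd>\<^sub>* b) (x \<rhd> y) =
      (a \<lhd>\<^sub>* (b \<circ> L\<^sub>\<rhd> x)) y - (a \<lhd>\<^sub>* (b \<circ> L\<^sub>\<lhd> x)) y + ((a \<circ> R\<^sub>\<rhd> y) \<lhd>\<^sub>* b) x"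
    and compat7: "\<lbrakk>a \<in> D; b \<in> D\<rbrakk> \<Longrightarrow> (a \<lhd>\<^sub>* b) (x \<lhd> y) = ((a \<circ> R\<^sub>\<lhd> y) \<lhd>\<^sub>* b) x
      - ((a \<rhd>\<^sub>* (b \<circ> L\<^sub>\<rhd> x)) y - (a \<rhd>\<^sub>* (b \<circ> L\<^sub>\<lhd> x)) y
         - ((a \<lhd>\<^sub>* (b \<circ> L\<^sub>\<rhd> x)) y - (a \<lhd>\<^sub>* (b \<circ> L\<^sub>\<lhd> x)) y))"
    and compat8: "\<lbrakk>a \<in> D; b \<in> D\<rbrakk> \<Longrightarrow>
      ((a \<circ> L\<^sub>\<rhd> x) \<rhd>\<^sub>* b) y - ((a \<circ> L\<^sub>\<lhd> x) \<rhd>\<^sub>* b) y + ((b \<circ> L\<^sub>\<lhd> y) \<lhd>\<^sub>* a) x =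
      (b \<rhd>\<^sub>* (a \<circ> R\<^sub>\<rhd> y)) x - (b \<rhd>\<^sub>* (a \<circ> R\<^sub>\<lhd> y)) x
        - ((b \<lhd>\<^sub>* (a \<circ> R\<^sub>\<rhd> y)) x - (b \<lhd>\<^sub>* (a \<circ> R\<^sub>\<lhd> y)) x) + (a \<rhd>\<^sub>* (b \<circ> R\<^sub>\<lhd> x)) y"
    and compat9: "\<lbrakk>a \<in> D; b \<in> D\<rbrakk> \<Longrightarrow>
      (b \<lhd>\<^sub>* (a \<circ> R\<^sub>\<lhd> x)) y + ((a \<rhd>\<^sub>* (b \<circ> R\<^sub>\<rhd> y)) x - (a \<lhd>\<^sub>* (b \<circ> R\<^sub>\<rhd> y)) x) =
      ((a \<circ> L\<^sub>\<rhd> y) \<rhd>\<^sub>* b) x - ((a \<circ> L\<^sub>\<lhd> y) \<rhd>\<^sub>* b) x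
        - (((a \<circ> L\<^sub>\<rhd> y) \<lhd>\<^sub>* b) x - ((a \<circ> L\<^sub>\<lhd> y) \<lhd>\<^sub>* b) x) + ((b \<circ> L\<^sub>\<rhd> x) \<lhd>\<^sub>* a) y"
begin

lemma coadjoint_matched_pair_right:
  "assoc_matched_pair s UNIV (\<rhd>) dual_scale D (\<rhd>\<^sub>*) lrA rrA lrB rrB"
\<comment> \<open>The last variable of each case is the test argument: a vector for an equation
  between functionals, a functional for an equation between vectors.\<close>
proof ((intro assoc_matched_pair.intro assoc_matched_pair_axioms.intro
    dialgebra_bimodule.axioms(2)[OF coadjoint_bimodule]
    dialgebra_bimodule.axioms(2)[OF coadjoint_dual_bimodule];
    unfold fun_eq_iff dual_separates; intro allI ballI), goal_cases)
  case (1 x a b y)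
  then show ?case using compat5[of a b y x] by (simp add: pairing_simps; algebra)
next
  \<comment> \<open>The right action is a difference, so this is \<open>compat4\<close> minus
    \<open>compat5\<close>; \<open>compat1\<close> cancels the two surplus terms.\<close>
  case (2 x a b y)
  then show ?case
    using compat1[of a b x y] compat4[of a b x y] compat5[of a b x y]
    by (simp add: pairing_simps; algebra)
next
  \<comment> \<open>In a left action on the space the test functional \<open>b\<close> becomes the
    left factor, hence the exchange of \<open>a\<close> and \<open>b\<close>. In a right action it
    is the right factor.\<close>
  case (3 x y a b)
  then show ?case using compat6[of b a x y] by (simp add: pairing_simps; algebra)
next
  case (4 x y a b)
  then show ?case
    using compat1[of a b x y] compat4[of a b x y] compat6[of a b x y]
    by (simp add: pairing_simps; algebra)
next
  case (5 x a b y)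
  then show ?case using compat8[of a b x y] by (simp add: pairing_simps; algebra)
next
  case (6 x y a b)
  then show ?case using compat9[of a b x y] by (simp add: pairing_simps; algebra)
qed

text \<open>Both left actions are differences, so law 1 is \<open>compat7\<close> minus
  \<open>compat6\<close> and law 3 is \<open>compat7\<close> minus \<open>compat5\<close>. In laws 2
  and 4 \<open>compat1\<close> exchanges one term.\<close>

lemma coadjoint_matched_pair_left:
  "assoc_matched_pair s UNIV (\<lhd>) dual_scale D (\<lhd>\<^sub>*) llA rlA llB rlB"
proof ((intro assoc_matched_pair.intro assoc_matched_pair_axioms.intro
    dialgebra_bimodule.axioms(3)[OF coadjoint_bimodule]
    dialgebra_bimodule.axioms(3)[OF coadjoint_dual_bimodule];
    unfold fun_eq_iff dual_separates; intro allI ballI), goal_cases)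
  case (1 x a b y)
  then show ?case
    using compat6[of a b y x] compat7[of a b y x]
    by (simp add: pairing_simps; algebra)
next
  case (2 x a b y)
  then show ?case
    using compat1[of a b x y] compat6[of a b x y]
    by (simp add: pairing_simps; algebra)
next
  case (3 x y a b)
  then show ?case
    using compat5[of b a x y] compat7[of b a x y]
    by (simp add: pairing_simps; algebra)
next
  case (4 x y a b)
  then show ?case
    using compat1[of a b x y] compat5[of a b x y]
    by (simp add: pairing_simps; algebra)
next
  case (5 x a b y)
  then show ?case
    using compat3[of a b y x] compat9[of b a x y]
    by (simp add: pairing_simps algebra_simps)
next
  case (6 x y a b)
  then show ?case
    using compat2[of a b y x] compat8[of a b y x]
    by (simp add: pairing_simps algebra_simps)
qed

text \<open>Laws valued in the space and in the dual pair off on the same equations: 1 and 17 on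
  \<open>compat2\<close>, \<open>compat8\<close>; 2 and 16 on \<open>compat1\<close>,
  \<open>compat5\<close>; 4 and 14 on \<open>compat3\<close>, \<open>compat9\<close>; 5 and 13 on
  \<open>compat1\<close>, \<open>compat6\<close>; 7 and 10 on \<open>compat7\<close>; 9 and 12 on
  \<open>compat4\<close>.\<close>

theorem coadjoint_matched_pair:
  "dialgebra_matched_pair s UNIV (\<rhd>) (\<lhd>) dual_scale D (\<rhd>\<^sub>*) (\<lhd>\<^sub>*) lrA rrA llA rlA lrB rrB llB rlB"
proof ((intro dialgebra_matched_pair.intro dialgebra_matched_pair_axioms.intro
    coadjoint_bimodule coadjoint_dual_bimodule
    coadjoint_matched_pair_right coadjoint_matched_pair_left;
    unfold fun_eq_iff dual_separates; intro allI ballI), goal_cases)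
  case (1 x y a b)
  then show ?case
    using compat2[of a b y x] compat8[of a b y x]
    by (simp add: pairing_simps algebra_simps)
next
  case (2 x y a b)
  then show ?case
    using compat5[of a b x y] compat1[of a b x y]
    by (simp add: pairing_simps; algebra)
next
  \<comment> \<open>Cases 3, 6, 15 and 18 all say, up to names, that
    \<open>a \<rhd>\<^sub>* b - a \<lhd>\<^sub>* b\<close> vanishes at
    \<open>x \<rhd> y - x \<lhd> y\<close>. This is the alternating sum of \<open>compat4\<close> to
    \<open>compat7\<close>, whose two surviving terms cancel by \<open>compat1\<close>.\<close>
  case (3 x a b y)
  then show ?case
    using compat1[of a b y x] compat4[of a b y x] compat5[of a b y x] compat6[of a b y x]
      compat7[of a b y x]
    by (simp add: pairing_simps; algebra)
next
  case (4 x a b y)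
  then show ?case
    using compat9[of b a x y] compat3[of a b y x]
    by (simp add: pairing_simps; algebra)
next
  case (5 x a b y)
  then show ?case
    using compat1[of a b x y] compat6[of a b x y]
    by (simp add: pairing_simps; algebra)
next
  case (6 x y a b)
  then show ?case
    using compat1[of b a x y] compat4[of b a x y] compat6[of b a x y] compat5[of b a x y]
      compat7[of b a x y]
    by (simp add: pairing_simps; algebra)
next
  case (7 x y a b)
  then show ?case using compat7[of b a x y] by (simp add: pairing_simps; algebra)
next
  case (8 x y a b)
  then show ?case
    using compat9[of a b x y] compat2[of a b y x] compat8[of b a x y]
    by (simp add: pairing_simps; algebra)
next
  case (9 x y a b)
  then show ?case using compat4[of a b x y] by (simp add: pairing_simps; algebra)
next
  case (10 x a b y)
  then show ?case using compat7[of a b y x] by (simp add: pairing_simps; algebra)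
next
  case (11 x a b y)
  then show ?case
    using compat8[of a b x y] compat3[of a b y x] compat9[of a b y x]
    by (simp add: pairing_simps; algebra)
next
  case (12 x a b y)
  then show ?case using compat4[of a b x y] by (simp add: pairing_simps; algebra)
next
  case (13 x y a b)
  then show ?case
    using compat1[of b a x y] compat6[of b a x y]
    by (simp add: pairing_simps; algebra)
next
  case (14 x y a b)
  then show ?case
    using compat3[of a b x y] compat9[of a b x y]
    by (simp add: pairing_simps; algebra)
next
  case (15 x y a b)
  then show ?case
    using compat5[of a b x y] compat7[of a b x y] compat1[of a b x y] compat4[of a b x y]
      compat6[of a b x y]
    by (simp add: pairing_simps; algebra)
next
  case (16 x a b y)
  then show ?case
    using compat1[of a b y x] compat5[of a b y x]
    by (simp add: pairing_simps; algebra)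
next
  case (17 x a b y)
  then show ?case
    using compat2[of a b x y] compat8[of a b x y]
    by (simp add: pairing_simps algebra_simps)
next
  case (18 x a b y)
  then show ?case
    using compat6[of a b x y] compat7[of a b x y] compat1[of a b x y] compat4[of a b x y]
      compat5[of a b x y]
    by (simp add: pairing_simps; algebra)
qed

end

section \<open>Double constructions\<close>

context dual_dialgebras
begin

abbreviation "double_right \<equiv> matched_product (\<rhd>) (\<rhd>\<^sub>*) lrA rrA lrB rrB"
abbreviation "double_left \<equiv> matched_product (\<lhd>) (\<lhd>\<^sub>*) llA rlA llB rlB"

text \<open>The laws come from \<open>dialgebra_sum\<close>. Invariance is an identity of pairings,
  because the actions are transposes of multiplications.\<close>

lemma double_construction_matched_product:
  assumes "dialgebra_matched_pair s UNIV (\<rhd>) (\<lhd>) dual_scale D (\<rhd>\<^sub>*) (\<lhd>\<^sub>*)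
    lrA rrA llA rlA lrB rrB llB rlB"
  shows "double_construction s (\<rhd>) (\<lhd>) (\<rhd>\<^sub>*) (\<lhd>\<^sub>*) double_right double_left"
proof -
  interpret M: dialgebra_matched_pair s UNIV "(\<rhd>)" "(\<lhd>)" dual_scale D "(\<rhd>\<^sub>*)" "(\<lhd>\<^sub>*)"
    lrA rrA llA rlA lrB rrB llB rlB
    by fact
  have "invariant_form (UNIV \<times> D) double_right double_left double_form"
    unfolding invariant_form_def
    by (auto simp: double_form_def matched_product_def pairing_simps algebra_simps)
  then show ?thesis
    using M.dialgebra_sum M.R.component_zero M.L.component_zero
    by (auto simp: double_construction_def matched_product_def M.R.component_zero
        M.L.component_zero dual_closed)
qed

text \<open>A double construction constrains the products only on the carrier. Invariance at three
  homogeneous arguments, two from one summand, expresses a mixed product through a product known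
  inside that summand.\<close>

lemma double_construction_unique:
  assumes "double_construction s (\<rhd>) (\<lhd>) (\<rhd>\<^sub>*) (\<lhd>\<^sub>*) dr dl" "p \<in> UNIV \<times> D" "q \<in> UNIV \<times> D"
  shows "dr p q = double_right p q" "dl p q = double_left p q"
proof -
  interpret E: dialgebra "prod_scale s dual_scale" "UNIV \<times> D" dr dl
    using assms(1) by (simp add: double_construction_def)
  have restrict: "dr (x, 0) (y, 0) = (x \<rhd> y, 0)" "dl (x, 0) (y, 0) = (x \<lhd> y, 0)"
      "a \<in> D \<Longrightarrow> b \<in> D \<Longrightarrow> dr (0, a) (0, b) = (0, a \<rhd>\<^sub>* b)"
      "a \<in> D \<Longrightarrow> b \<in> D \<Longrightarrow> dl (0, a) (0, b) = (0, a \<lhd>\<^sub>* b)" for x y a b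
    using assms(1) by (simp_all add: double_construction_def)
  have inv: "double_form (dr p q) r = double_form p (dr q r - dl q r)"
      "double_form (dl p q) r = double_form p (dr q r)"
    if "p \<in> UNIV \<times> D" "q \<in> UNIV \<times> D" "r \<in> UNIV \<times> D" for p q r
    using assms(1) that unfolding double_construction_def invariant_form_def by blast+
  have "dr p q \<in> UNIV \<times> D" "dl p q \<in> UNIV \<times> D" if "p \<in> UNIV \<times> D" "q \<in> UNIV \<times> D" for p q
    using E.R.mult_bilinear E.L.mult_bilinear that unfolding bilinear_on_def by blast+
  then have closed: "snd (dr p q) \<in> D" "snd (dl p q) \<in> D"
    if "p \<in> UNIV \<times> D" "q \<in> UNIV \<times> D" for p q
    using that by (simp_all only: mem_Times_iff)
  note eval = double_form_def restrict closed dual_closed dual_mult_closed dual_linear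
  have right_left: "dr (x, 0) (0, b) = double_right (x, 0) (0, b)"
      "dl (x, 0) (0, b) = double_left (x, 0) (0, b)"
      "dr (0, b) (x, 0) = double_right (0, b) (x, 0)"
      "dl (0, b) (x, 0) = double_left (0, b) (x, 0)" if b: "b \<in> D" for x b
  proof -
    \<comment> \<open>In facts 1 to 4 the mixed product stands in the first slot of the form.
      Pairing with \<open>(0, v)\<close> or \<open>(u, 0)\<close> reads off one component.\<close>
    have 1: "v (fst (dr (x, 0) (0, b))) = (b \<rhd>\<^sub>* v) x - (b \<lhd>\<^sub>* v) x" if "v \<in> D" for v
      using inv(1)[of "(x, 0)" "(0, b)" "(0, v)"] b that by (simp add: eval; algebra)
    have 2: "v (fst (dl (x, 0) (0, b))) = (b \<rhd>\<^sub>* v) x" if "v \<in> D" for v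
      using inv(2)[of "(x, 0)" "(0, b)" "(0, v)"] b that by (simp add: eval; algebra)
    have 3: "snd (dr (0, b) (x, 0)) u = b (x \<rhd> u) - b (x \<lhd> u)" for u
      using inv(1)[of "(0, b)" "(x, 0)" "(u, 0)"] b by (simp add: eval; algebra)
    have 4: "snd (dl (0, b) (x, 0)) u = b (x \<rhd> u)" for u
      using inv(2)[of "(0, b)" "(x, 0)" "(u, 0)"] b by (simp add: eval; algebra)
    \<comment> \<open>For the other four components the mixed product stands in the second slot.
      There \<open>\<lhd>\<close> occurs only within a difference, so 6 and 8 rely on 5 and
      7.\<close>
    have 5: "v (fst (dr (0, b) (x, 0))) = (v \<lhd>\<^sub>* b) x" if "v \<in> D" for v
      using inv(2)[of "(0, v)" "(0, b)" "(x, 0)"] b that by (simp add: eval; algebra)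
    have 6: "v (fst (dl (0, b) (x, 0))) = (v \<lhd>\<^sub>* b) x - (v \<rhd>\<^sub>* b) x" if "v \<in> D" for v
      using inv(1)[of "(0, v)" "(0, b)" "(x, 0)"] 5[OF that] b that by (simp add: eval; algebra)
    have 7: "snd (dr (x, 0) (0, b)) u = b (u \<lhd> x)" for u
      using inv(2)[of "(u, 0)" "(x, 0)" "(0, b)"] b by (simp add: eval; algebra)
    have 8: "snd (dl (x, 0) (0, b)) u = b (u \<lhd> x) - b (u \<rhd> x)" for u
      using inv(1)[of "(u, 0)" "(x, 0)" "(0, b)"] 7[of u] b by (simp add: eval; algebra)
    show "dr (x, 0) (0, b) = double_right (x, 0) (0, b)"
      "dl (x, 0) (0, b) = double_left (x, 0) (0, b)"
      "dr (0, b) (x, 0) = double_right (0, b) (x, 0)"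
      "dl (0, b) (x, 0) = double_left (0, b) (x, 0)"
      using b
      by (simp_all add: prod_eq_iff matched_product_def dual_separates fun_eq_iff pairing_simps
          1 2 3 4 5 6 7 8)
  qed
  obtain x a y b where pq: "p = (x, 0) + (0, a)" "q = (y, 0) + (0, b)" "a \<in> D" "b \<in> D"
    using assms(2,3) by (cases p; cases q) auto
  have add: "m (u + v) w = m u w + m v w" "m w (u + v) = m w u + m w v"
    if "m \<in> {dr, dl}" "u \<in> UNIV \<times> D" "v \<in> UNIV \<times> D" "w \<in> UNIV \<times> D" for m u v w
    using E.R.mult_bilinear E.L.mult_bilinear that unfolding bilinear_on_def linear_on_def by auto
  \<comment> \<open>\<open>add_Pair\<close> would merge the homogeneous summands before additivity
    splits the product.\<close>
  have "m ((x, 0) + (0, a)) ((y, 0) + (0, b)) =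
      m (x, 0) (y, 0) + m (x, 0) (0, b) + (m (0, a) (y, 0) + m (0, a) (0, b))"
    if "m \<in> {dr, dl}" for m
    using that pq(3,4) assms(2,3)[unfolded pq(1,2)]
    by (simp add: add dual_closed del: add_Pair)
  from this[of dr] this[of dl] show "dr p q = double_right p q" "dl p q = double_left p q"
    unfolding pq(1,2) using pq(3,4)
    by (simp_all add: restrict right_left matched_product_def dual_separates fun_eq_iff
        pairing_simps algebra_simps)
qed

text \<open>By uniqueness the laws of the given dialgebra pass to the explicit products, where they
  can be evaluated.\<close>

lemma compatible_if_double_construction:
  assumes dc: "double_construction s (\<rhd>) (\<lhd>) (\<rhd>\<^sub>*) (\<lhd>\<^sub>*) dr dl"
  shows "compatible_dual_dialgebras s Basis (\<rhd>) (\<lhd>) (\<rhd>\<^sub>*) (\<lhd>\<^sub>*)"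
proof -
  interpret E: dialgebra "prod_scale s dual_scale" "UNIV \<times> D" dr dl
    using assms(1) by (simp add: double_construction_def)
  have closed: "dr p q \<in> UNIV \<times> D" "dl p q \<in> UNIV \<times> D"
    if "p \<in> UNIV \<times> D" "q \<in> UNIV \<times> D" for p q
    using E.R.mult_bilinear E.L.mult_bilinear that unfolding bilinear_on_def by blast+
  have laws: "double_right (double_right p q) r = double_right p (double_right q r)"
      "double_left (double_left p q) r = double_left p (double_left q r)"
      "double_left (double_right p q) r = double_right p (double_left q r)"
    if "p \<in> UNIV \<times> D" "q \<in> UNIV \<times> D" "r \<in> UNIV \<times> D" for p q r
    using E.R.mult_assoc[OF that] E.L.mult_assoc[OF that] E.right_left[OF that] that
    by (simp_all only: double_construction_unique[OF dc, symmetric] closed)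
  note eval = matched_product_def pairing_simps
  \<comment> \<open>Each equation is one law at a homogeneous mixed triple, read in the component
    that is not a bimodule law.\<close>
  have c4: "(a \<rhd>\<^sub>* b) (x \<rhd> y) = (a \<rhd>\<^sub>* (b \<circ> L\<^sub>\<rhd> x)) y
      - (((a \<circ> R\<^sub>\<rhd> y) \<rhd>\<^sub>* b) x - ((a \<circ> R\<^sub>\<lhd> y) \<rhd>\<^sub>* b) x
         - (((a \<circ> R\<^sub>\<rhd> y) \<lhd>\<^sub>* b) x - ((a \<circ> R\<^sub>\<lhd> y) \<lhd>\<^sub>* b) x))"
    if "a \<in> D" "b \<in> D" for a b x y
    using arg_cong[OF laws(3)[of "(x, 0)" "(y, 0)" "(0, a)"], of "\<lambda>p. b (fst p)"] that
    by (simp add: eval; algebra)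
  have c5: "(a \<rhd>\<^sub>* b) (x \<lhd> y) =
      (a \<rhd>\<^sub>* (b \<circ> L\<^sub>\<lhd> x)) y - (a \<lhd>\<^sub>* (b \<circ> L\<^sub>\<lhd> x)) y + ((a \<circ> R\<^sub>\<lhd> y) \<rhd>\<^sub>* b) x"
    if "a \<in> D" "b \<in> D" for a b x y
    using arg_cong[OF laws(1)[of "(y, 0)" "(0, a)" "(0, b)"], of "\<lambda>p. snd p x"] that
    by (simp add: eval algebra_simps)
  have c6: "(a \<lhd>\<^sub>* b) (x \<rhd> y) =
      (a \<lhd>\<^sub>* (b \<circ> L\<^sub>\<rhd> x)) y - (a \<lhd>\<^sub>* (b \<circ> L\<^sub>\<lhd> x)) y + ((a \<circ> R\<^sub>\<rhd> y) \<lhd>\<^sub>* b) x"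
    if "a \<in> D" "b \<in> D" for a b x y
    using arg_cong[OF laws(1)[of "(0, b)" "(x, 0)" "(y, 0)"], of "\<lambda>p. a (fst p)"] that
    by (simp add: eval algebra_simps)
  have c7: "(a \<lhd>\<^sub>* b) (x \<lhd> y) = ((a \<circ> R\<^sub>\<lhd> y) \<lhd>\<^sub>* b) x
      - ((a \<rhd>\<^sub>* (b \<circ> L\<^sub>\<rhd> x)) y - (a \<rhd>\<^sub>* (b \<circ> L\<^sub>\<lhd> x)) y
         - ((a \<lhd>\<^sub>* (b \<circ> L\<^sub>\<rhd> x)) y - (a \<lhd>\<^sub>* (b \<circ> L\<^sub>\<lhd> x)) y))"
    if "a \<in> D" "b \<in> D" for a b x y
    using arg_cong[OF laws(3)[of "(y, 0)" "(0, a)" "(0, b)"], of "\<lambda>p. snd p x"] that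
    by (simp add: eval algebra_simps)
  have c8: "((a \<circ> L\<^sub>\<rhd> x) \<rhd>\<^sub>* b) y - ((a \<circ> L\<^sub>\<lhd> x) \<rhd>\<^sub>* b) y + ((b \<circ> L\<^sub>\<lhd> y) \<lhd>\<^sub>* a) x =
      (b \<rhd>\<^sub>* (a \<circ> R\<^sub>\<rhd> y)) x - (b \<rhd>\<^sub>* (a \<circ> R\<^sub>\<lhd> y)) x
        - ((b \<lhd>\<^sub>* (a \<circ> R\<^sub>\<rhd> y)) x - (b \<lhd>\<^sub>* (a \<circ> R\<^sub>\<lhd> y)) x) + (a \<rhd>\<^sub>* (b \<circ> R\<^sub>\<lhd> x)) y"
    if "a \<in> D" "b \<in> D" for a b x y
    using arg_cong[OF laws(1)[of "(0, a)" "(x, 0)" "(0, b)"], of "\<lambda>p. snd p y"] that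
    by (simp add: eval; algebra)
  have c9: "(b \<lhd>\<^sub>* (a \<circ> R\<^sub>\<lhd> x)) y + ((a \<rhd>\<^sub>* (b \<circ> R\<^sub>\<rhd> y)) x - (a \<lhd>\<^sub>* (b \<circ> R\<^sub>\<rhd> y)) x) =
      ((a \<circ> L\<^sub>\<rhd> y) \<rhd>\<^sub>* b) x - ((a \<circ> L\<^sub>\<lhd> y) \<rhd>\<^sub>* b) x
        - (((a \<circ> L\<^sub>\<rhd> y) \<lhd>\<^sub>* b) x - ((a \<circ> L\<^sub>\<lhd> y) \<lhd>\<^sub>* b) x) + ((b \<circ> L\<^sub>\<rhd> x) \<lhd>\<^sub>* a) y"
    if "a \<in> D" "b \<in> D" for a b x y
    using arg_cong[OF laws(1)[of "(x, 0)" "(0, a)" "(y, 0)"], of "\<lambda>p. b (fst p)"] that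
    by (simp add: eval; algebra)
  \<comment> \<open>The last three equations arise by comparing associativity of
    \<open>\<lhd>\<close> with \<open>c5\<close>, \<open>c8\<close> and \<open>c9\<close>, which is
    why they come after them.\<close>
  have c1: "(a \<lhd>\<^sub>* (b \<circ> L\<^sub>\<lhd> x)) y = ((a \<circ> R\<^sub>\<rhd> y) \<rhd>\<^sub>* b) x" if "a \<in> D" "b \<in> D" for a b x y
    using arg_cong[OF laws(2)[of "(x, 0)" "(y, 0)" "(0, a)"], of "\<lambda>p. b (fst p)"]
      c5[OF that, of x y] that
    by (simp add: eval; algebra)
  have c2: "((a \<circ> L\<^sub>\<lhd> x) \<rhd>\<^sub>* b) y = ((b \<circ> L\<^sub>\<lhd> y) \<rhd>\<^sub>* a) x" if "a \<in> D" "b \<in> D" for a b x y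
    using arg_cong[OF laws(2)[of "(y, 0)" "(0, a)" "(x, 0)"], of "\<lambda>p. b (fst p)"]
      c8[OF that, of x y] that
    by (simp add: eval; algebra)
  have c3: "(b \<lhd>\<^sub>* (a \<circ> R\<^sub>\<rhd> x)) y = (a \<lhd>\<^sub>* (b \<circ> R\<^sub>\<rhd> y)) x" if "a \<in> D" "b \<in> D" for a b x y
    using arg_cong[OF laws(2)[of "(0, b)" "(x, 0)" "(0, a)"], of "\<lambda>p. snd p y"]
      c9[OF that, of x y] that
    by (simp add: eval; algebra)
  show ?thesis
    by unfold_locales (fact c1 c2 c3 c4 c5 c6 c7 c8 c9)+
qed

lemma bidialgebra_iff_compatible:
  assumes "linear_dual s (\<rhd>\<^sub>*) cr" "linear_dual s (\<lhd>\<^sub>*) cl"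
  shows "bidialgebra s (\<rhd>) (\<lhd>) cr cl \<longleftrightarrow>
    compatible_dual_dialgebras s Basis (\<rhd>) (\<lhd>) (\<rhd>\<^sub>*) (\<lhd>\<^sub>*)"
proof -
  \<comment> \<open>Tensors vanish outside \<open>D\<close> by convention; the conditional makes
    these rules unconditional.\<close>
  have co_apply: "cr x a b = (if a \<in> D \<and> b \<in> D then (a \<rhd>\<^sub>* b) x else 0)"
      "cl x a b = (if a \<in> D \<and> b \<in> D then (a \<lhd>\<^sub>* b) x else 0)" for x a b
    using assms unfolding linear_dual_def tensor2_space_def tensor2_pairing_def
    by (auto simp: image_subset_iff)
  \<comment> \<open>As a function of \<open>x\<close>, the value \<open>cr x b c\<close> is the dual
    product of \<open>b\<close> and \<open>c\<close>, so a nested coproduct becomes a nested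
    product.\<close>
  have co_tensor:
      "id_tensor_co cr t a b c = t a (if b \<in> D \<and> c \<in> D then b \<rhd>\<^sub>* c else 0)"
      "id_tensor_co cl t a b c = t a (if b \<in> D \<and> c \<in> D then b \<lhd>\<^sub>* c else 0)"
      "co_tensor_id cr t a b c = t (if a \<in> D \<and> b \<in> D then a \<rhd>\<^sub>* b else 0) c"
      "co_tensor_id cl t a b c = t (if a \<in> D \<and> b \<in> D then a \<lhd>\<^sub>* b else 0) c" for t a b c
    by (auto simp: id_tensor_co_def co_tensor_id_def co_apply zero_fun_def)
  have star: "a \<circ> L_mult (\<lambda>x y. x \<rhd> y - x \<lhd> y) x = (a \<circ> L\<^sub>\<rhd> x) - (a \<circ> L\<^sub>\<lhd> x)"
      "a \<circ> R_mult (\<lambda>x y. x \<rhd> y - x \<lhd> y) x = (a \<circ> R\<^sub>\<rhd> x) - (a \<circ> R\<^sub>\<lhd> x)" if "a \<in> D" for a x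
    using that by (simp_all add: fun_eq_iff L_mult_def R_mult_def dual_linear)
  note eval = co_apply star tensor_map_def tensor_swap_def comp_mult_dual dual_closed dual_mult_diff
  show ?thesis
  proof
    assume "bidialgebra s (\<rhd>) (\<lhd>) cr cl"
    note bi = bidialgebra.bi1[OF this] bidialgebra.bi2[OF this] bidialgebra.bi3[OF this]
      bidialgebra.bi4[OF this] bidialgebra.bi5[OF this] bidialgebra.bi6[OF this]
      bidialgebra.bi7[OF this] bidialgebra.bi8[OF this] bidialgebra.bi9[OF this]
    show "compatible_dual_dialgebras s Basis (\<rhd>) (\<lhd>) (\<rhd>\<^sub>*) (\<lhd>\<^sub>*)"
    proof (unfold_locales, goal_cases)
      case (1 a b x y)
      then show ?case using fun_cong[OF fun_cong[OF bi(1)[of x y]], of a b] by (simp add: eval)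
    next
      case (2 a b x y)
      then show ?case using fun_cong[OF fun_cong[OF bi(2)[of x y]], of a b] by (simp add: eval)
    next
      case (3 a b x y)
      then show ?case using fun_cong[OF fun_cong[OF bi(3)[of x y]], of a b] by (simp add: eval)
    next
      case (4 a b x y)
      then show ?case using fun_cong[OF fun_cong[OF bi(4)[of x y]], of a b] by (simp add: eval)
    next
      case (5 a b x y)
      then show ?case using fun_cong[OF fun_cong[OF bi(5)[of x y]], of a b] by (simp add: eval)
    next
      case (6 a b x y)
      then show ?case using fun_cong[OF fun_cong[OF bi(6)[of x y]], of a b] by (simp add: eval)
    next
      case (7 a b x y)
      then show ?case using fun_cong[OF fun_cong[OF bi(7)[of x y]], of a b] by (simp add: eval)
    next
      case (8 a b x y)
      then show ?case using fun_cong[OF fun_cong[OF bi(8)[of x y]], of a b] by (simp add: eval)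
    next
      case (9 a b x y)
      then show ?case using fun_cong[OF fun_cong[OF bi(9)[of x y]], of a b] by (simp add: eval)
    qed
  next
    assume "compatible_dual_dialgebras s Basis (\<rhd>) (\<lhd>) (\<rhd>\<^sub>*) (\<lhd>\<^sub>*)"
    then interpret C: compatible_dual_dialgebras s Basis "(\<rhd>)" "(\<lhd>)" "(\<rhd>\<^sub>*)" "(\<lhd>\<^sub>*)" .
    note laws = B.R.mult_assoc B.left_left B.right_left B.left_right B.left_nested
    \<comment> \<open>The co-dialgebra laws are the dialgebra laws of the dual;
      \<open>co_left_left\<close> is its \<open>left_nested\<close>. Arguments outside
      \<open>D\<close> give 0 on both sides.\<close>
    have "codialgebra s cr cl"
    proof (intro codialgebra.intro codialgebra_axioms.intro vector_space_axioms)
      show "Vector_Spaces.linear s tensor2_scale cr" "Vector_Spaces.linear s tensor2_scale cl"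
        using assms by (simp_all add: linear_dual_def)
      show "cr x \<in> tensor2_space s" "cl x \<in> tensor2_space s" for x
        using assms by (auto simp: linear_dual_def)
    qed (auto simp: fun_eq_iff co_tensor co_apply laws dual_mult_closed dual_mult_zero dual_closed)
    show "bidialgebra s (\<rhd>) (\<lhd>) cr cl"
    proof ((intro bidialgebra.intro dialgebra_codialgebra.intro bidialgebra_axioms.intro
        A.dialgebra_axioms \<open>codialgebra s cr cl\<close>; intro ext), goal_cases)
      case (1 x y a b)
      show ?case using C.compat1[of a b x y] by (simp add: eval)
    next
      case (2 x y a b)
      show ?case using C.compat2[of a b x y] by (simp add: eval)
    next
      case (3 x y a b)
      show ?case using C.compat3[of a b x y] by (simp add: eval)
    next
      case (4 x y a b)
      show ?case using C.compat4[of a b x y] by (simp add: eval)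
    next
      case (5 x y a b)
      show ?case using C.compat5[of a b x y] by (simp add: eval)
    next
      case (6 x y a b)
      show ?case using C.compat6[of a b x y] by (simp add: eval)
    next
      case (7 x y a b)
      show ?case using C.compat7[of a b x y] by (simp add: eval)
    next
      case (8 x y a b)
      show ?case using C.compat8[of a b x y] by (simp add: eval)
    next
      case (9 x y a b)
      show ?case using C.compat9[of a b x y] by (simp add: eval)
    qed
  qed
qed

end

theorem theorem3p10:
  fixes s :: "'f::field_char_0 \<Rightarrow> 'a::ab_group_add \<Rightarrow> 'a"
    and Basis :: "'a set"
    and drA dlA :: "'a \<Rightarrow> 'a \<Rightarrow> 'a"
    and drB dlB :: "('a \<Rightarrow> 'f) \<Rightarrow> ('a \<Rightarrow> 'f) \<Rightarrow> ('a \<Rightarrow> 'f)"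
    and cr cl :: "'a \<Rightarrow> ('a, 'f) tensor2"
  assumes "finite_dimensional_vector_space s Basis"
    and "dialgebra s UNIV drA dlA"
    and "dialgebra dual_scale (dual_space s) drB dlB"
    and "linear_dual s drB cr"
    and "linear_dual s dlB cl"
  shows "((\<exists>dr dl. double_construction s drA dlA drB dlB dr dl) \<longleftrightarrow>
          dialgebra_matched_pair s UNIV drA dlA dual_scale (dual_space s) drB dlB
            (- dual_rep (R_mult dlA))
            (dual_rep (L_mult dlA) - dual_rep (L_mult drA))
            (dual_rep (R_mult drA) - dual_rep (R_mult dlA))
            (- dual_rep (L_mult drA))
            (- codual_rep s (R_mult dlB))
            (codual_rep s (L_mult dlB) - codual_rep s (L_mult drB))
            (codual_rep s (R_mult drB) - codual_rep s (R_mult dlB))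
            (- codual_rep s (L_mult drB))) \<and>
         ((\<exists>dr dl. double_construction s drA dlA drB dlB dr dl) \<longleftrightarrow>
          bidialgebra s drA dlA cr cl)"
proof -
  interpret dual_dialgebras s Basis drA dlA drB dlB
    using assms(1-3) by (simp add: dual_dialgebras_def)
  \<comment> \<open>The nine scalar equations link everything: (a) implies them, they imply (b), (b)
    implies (a), and they are equivalent to (c).\<close>
  show ?thesis
    using double_construction_matched_product compatible_if_double_construction
      compatible_dual_dialgebras.coadjoint_matched_pair bidialgebra_iff_compatible[OF assms(4,5)]
    by blast
qed

end
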